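(* Let $(\mathcal{O},p,q)$ be an admissible triple such that $q$ is a rational prime and $\mathcal{O}/p\mathcal{O}\simeq\mathbb{F}_q$. Then the lattice $L_q$ is $p$-modular, that is, $pL_q'=L_q$.
   Context: Admissible triple: $q$ is a power of a rational prime; $\mathcal{O}$ is either $\mathbb{Z}$, or the ring of integers of an imaginary quadratic number field, or Hurwitz's ring of integral quaternions (in which case modules are right modules); $p\in\mathcal{O}$ is a prime element with $|p|^2=q$ and $\bar z\equiv z \bmod p\mathcal{O}$ for all $z\in\mathcal{O}$. Put $n=q^2+q+1$. Hermitian forms $\langle\cdot\vert\cdot\rangle$ are linear in the second variable and conjugate-linear in the first. An $\mathcal{O}$-lattice is a finitely generated projective $\mathcal{O}$-module $L$ with an $\mathcal{O}$-valued Hermitian form with $\operatorname{Rad}(L)=0$, where $\operatorname{Rad}(L)=\{x\in L: \langle y\vert x\rangle=0\ \forall y\in L\}$. The dual $L'$ is the module of $\mathcal{O}$-valued linear functionals on $L$, identified via the form with $\{x\in L\otimes\operatorname{Frac}(\mathcal{O}):\langle y\vert x\rangle\in\mathcal{O}\ \forall y\in L\}\supseteq L$. $L$ is $p$-modular if $L'=p^{-1}L$. The lattice $L_q$: let $\mathcal{P}$ and $\mathcal{L}$ be the sets of points and lines of $\mathbb{P}^2(\mathbb{F}_q)$ ($n$ elements each), and write $x\in l$ for incidence. Let $L_q^\circ$ be the free $\mathcal{O}$-module of rank $2n$ with basis $\mathcal{P}\cup\mathcal{L}$ and Hermitian form determined on basis vectors by: $\langle r\vert r\rangle=-q$ for all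 $r\in\mathcal{P}\cup\mathcal{L}$; $\langle r\vert s\rangle=p$ if $r\in\mathcal{P}$, $s\in\mathcal{L}$, $r\in s$; $\langle r\vert s\rangle=\bar p$ if $r\in\mathcal{L}$, $s\in\mathcal{P}$, $s\in r$; and $0$ otherwise. Then $L_q=L_q^\circ/\operatorname{Rad}(L_q^\circ)$ with the induced form. *)

theory Defs
  imports
    "HOL-Analysis.Analysis"
    "HOL-Algebra.Ring_Divisibility"
    "HOL-Computational_Algebra.Squarefree"
    "HOL-Number_Theory.Prime_Powers"
begin

section \<open>Quaternions\<close>

text \<open>
  All three kinds of coefficient rings are realised inside Hamilton's quaternions, so that
  conjugation, absolute value and right modules need only be treated once.
\<close>

codatatype quat = Quat (qRe: real) (qI: real) (qJ: real) (qK: real)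

lemma quat_eq_iff: "x = y \<longleftrightarrow> qRe x = qRe y \<and> qI x = qI y \<and> qJ x = qJ y \<and> qK x = qK y"
  by (auto intro: quat.expand)

instantiation quat :: ab_group_add
begin

primcorec zero_quat where
  "qRe 0 = 0" | "qI 0 = 0" | "qJ 0 = 0" | "qK 0 = 0"

primcorec plus_quat where
  "qRe (x + y) = qRe x + qRe y"
| "qI (x + y) = qI x + qI y"
| "qJ (x + y) = qJ x + qJ y"
| "qK (x + y) = qK x + qK y"

primcorec uminus_quat where
  "qRe (- x) = - qRe x" | "qI (- x) = - qI x" | "qJ (- x) = - qJ x" | "qK (- x) = - qK x"

primcorec minus_quat where
  "qRe (x - y) = qRe x - qRe y"
| "qI (x - y) = qI x - qI y"
| "qJ (x - y) = qJ x - qJ y"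
| "qK (x - y) = qK x - qK y"

instance
  by standard (simp_all add: quat_eq_iff)

end

instantiation quat :: ring_1
begin

primcorec one_quat where
  "qRe 1 = 1" | "qI 1 = 0" | "qJ 1 = 0" | "qK 1 = 0"

primcorec times_quat where
  "qRe (x * y) = qRe x * qRe y - qI x * qI y - qJ x * qJ y - qK x * qK y"
| "qI (x * y) = qRe x * qI y + qI x * qRe y + qJ x * qK y - qK x * qJ y"
| "qJ (x * y) = qRe x * qJ y - qI x * qK y + qJ x * qRe y + qK x * qI y"
| "qK (x * y) = qRe x * qK y + qI x * qJ y - qJ x * qI y + qK x * qRe y"

instance
  by standard (simp_all add: quat_eq_iff algebra_simps)

end

instantiation quat :: division_ring
begin

primcorec inverse_quat where
  "qRe (inverse x) = qRe x / ((qRe x)\<^sup>2 + (qI x)\<^sup>2 + (qJ x)\<^sup>2 + (qK x)\<^sup>2)"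
| "qI (inverse x) = - qI x / ((qRe x)\<^sup>2 + (qI x)\<^sup>2 + (qJ x)\<^sup>2 + (qK x)\<^sup>2)"
| "qJ (inverse x) = - qJ x / ((qRe x)\<^sup>2 + (qI x)\<^sup>2 + (qJ x)\<^sup>2 + (qK x)\<^sup>2)"
| "qK (inverse x) = - qK x / ((qRe x)\<^sup>2 + (qI x)\<^sup>2 + (qJ x)\<^sup>2 + (qK x)\<^sup>2)"

definition "x div y = x * inverse y" for x y :: quat

instance
proof
  fix x y :: quat
  have pos: "(qRe x)\<^sup>2 + (qI x)\<^sup>2 + (qJ x)\<^sup>2 + (qK x)\<^sup>2 \<noteq> 0" if "x \<noteq> 0"
    using that by (auto simp: quat_eq_iff add_nonneg_eq_0_iff)
  show "inverse x * x = 1" if "x \<noteq> 0"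
    using pos[OF that]
    by (auto simp: quat_eq_iff power2_eq_square add_divide_distrib [symmetric]
        diff_divide_distrib [symmetric])
  show "x * inverse x = 1" if "x \<noteq> 0"
    using pos[OF that]
    by (auto simp: quat_eq_iff power2_eq_square add_divide_distrib [symmetric]
        diff_divide_distrib [symmetric])
qed (simp_all add: divide_quat_def quat_eq_iff)

end

definition qnorm :: "quat \<Rightarrow> real" where
  "qnorm z = sqrt ((qRe z)\<^sup>2 + (qI z)\<^sup>2 + (qJ z)\<^sup>2 + (qK z)\<^sup>2)"

primcorec qcnj :: "quat \<Rightarrow> quat" where
  "qRe (qcnj z) = qRe z" | "qI (qcnj z) = - qI z" | "qJ (qcnj z) = - qJ z" | "qK (qcnj z) = - qK z"

definition quat_of_complex :: "complex \<Rightarrow> quat" where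
  "quat_of_complex z = Quat (Re z) (Im z) 0 0"

section \<open>Admissible triples\<close>

definition imag_quadratic_field :: "complex set \<Rightarrow> bool" where
  "imag_quadratic_field K \<longleftrightarrow>
     (\<exists>d::nat. d > 0 \<and> squarefree d \<and>
        K = {of_rat a + of_rat b * (\<i> * of_real (sqrt (real d))) | a b. True})"

definition ring_of_integers :: "complex set \<Rightarrow> complex set" where
  "ring_of_integers K = {z \<in> K. algebraic_int z}"

definition hurwitz_integers :: "quat set" where
  "hurwitz_integers = {z. {qRe z, qI z, qJ z, qK z} \<subseteq> \<int> \<or>
     {qRe z - 1/2, qI z - 1/2, qJ z - 1/2, qK z - 1/2} \<subseteq> \<int>}"

definition ring_of :: "'a::ring_1 set \<Rightarrow> 'a ring" where
  "ring_of S = \<lparr>carrier = S, mult = (*), one = 1, zero = 0, add = (+)\<rparr>"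

definition right_multiples :: "quat set \<Rightarrow> quat \<Rightarrow> quat set" where
  "right_multiples \<O> p = {p * a | a. a \<in> \<O>}"

text \<open>
  In HOL-Algebra, \<open>a divides b\<close> means \<open>b = a \<otimes> c\<close> for some \<open>c\<close>, so primality of \<open>p\<close> below is:
  \<open>p\<close> is a nonzero non-unit, and \<open>a b \<in> p\<O>\<close> implies \<open>a \<in> p\<O>\<close> or \<open>b \<in> p\<O>\<close>.
\<close>

definition admissible :: "quat set \<Rightarrow> quat \<Rightarrow> nat \<Rightarrow> bool" where
  "admissible \<O> p q \<longleftrightarrow>
     primepow q \<and>
     (\<O> = \<int> \<or>
      (\<exists>K. imag_quadratic_field K \<and> \<O> = quat_of_complex ` ring_of_integers K) \<or>
      \<O> = hurwitz_integers) \<and>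
     p \<in> \<O> \<and> ring_prime\<^bsub>ring_of \<O>\<^esub> p \<and>
     (qnorm p)\<^sup>2 = real q \<and>
     (\<forall>z\<in>\<O>. qcnj z - z \<in> right_multiples \<O> p)"

section \<open>Right modules with a Hermitian form\<close>

record 'v herm_module =
  vecs :: "'v set"
  vadd :: "'v \<Rightarrow> 'v \<Rightarrow> 'v"
  vscale :: "'v \<Rightarrow> quat \<Rightarrow> 'v"
  form :: "'v \<Rightarrow> 'v \<Rightarrow> quat"

text \<open>
  The free right \<open>\<O>\<close>-module with basis \<open>B\<close>; a vector is its coordinate function, extended by 0
  outside \<open>B\<close>. The form is conjugate-linear in the first variable, linear in the second, with
  Gram matrix \<open>g\<close>.
\<close>

definition free_herm_module ::
    "quat set \<Rightarrow> 'b set \<Rightarrow> ('b \<Rightarrow> 'b \<Rightarrow> quat) \<Rightarrow> ('b \<Rightarrow> quat) herm_module" where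
  "free_herm_module \<O> B g =
     \<lparr>vecs = {v. (\<forall>r\<in>B. v r \<in> \<O>) \<and> (\<forall>r. r \<notin> B \<longrightarrow> v r = 0)},
      vadd = (\<lambda>u v r. u r + v r),
      vscale = (\<lambda>v a r. v r * a),
      form = (\<lambda>u v. \<Sum>r\<in>B. \<Sum>s\<in>B. qcnj (u r) * g r s * v s)\<rparr>"

definition radical :: "'v herm_module \<Rightarrow> 'v set" where
  "radical M = {x \<in> vecs M. \<forall>y\<in>vecs M. form M y x = 0}"

definition rad_coset :: "'v herm_module \<Rightarrow> 'v \<Rightarrow> 'v set" where
  "rad_coset M x = vadd M x ` radical M"

text \<open>
  The quotient by the radical. The form takes a single value on all pairs of representatives of
  two cosets.
\<close>

definition mod_radical :: "'v herm_module \<Rightarrow> 'v set herm_module" where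
  "mod_radical M =
     \<lparr>vecs = rad_coset M ` vecs M,
      vadd = (\<lambda>X Y. \<Union>x\<in>X. \<Union>y\<in>Y. rad_coset M (vadd M x y)),
      vscale = (\<lambda>X a. \<Union>x\<in>X. rad_coset M (vscale M x a)),
      form = (\<lambda>X Y. the_elem {form M x y | x y. x \<in> X \<and> y \<in> Y})\<rparr>"

text \<open>
  The dual consists of the \<open>\<O>\<close>-valued linear functionals. The form embeds \<open>L\<close> into it by
  \<open>x \<mapsto> \<langle>x|\<cdot>\<rangle>\<close>. As \<open>\<langle>x a|y\<rangle> = qcnj a * \<langle>x|y\<rangle>\<close>, this embedding is \<open>\<O>\<close>-linear for the right
  module structure \<open>(f a)(y) = qcnj a * f(y)\<close>; extended to \<open>L \<otimes> Frac \<O>\<close>, it identifies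
  \<open>{x. \<forall>y\<in>L. \<langle>y|x\<rangle> \<in> \<O>}\<close> with the dual.
\<close>

definition dual :: "quat set \<Rightarrow> 'v herm_module \<Rightarrow> ('v \<Rightarrow> quat) set" where
  "dual \<O> L = {f \<in> vecs L \<rightarrow>\<^sub>E \<O>.
     (\<forall>x\<in>vecs L. \<forall>y\<in>vecs L. f (vadd L x y) = f x + f y) \<and>
     (\<forall>x\<in>vecs L. \<forall>a\<in>\<O>. f (vscale L x a) = f x * a)}"

definition dual_scale :: "'v herm_module \<Rightarrow> ('v \<Rightarrow> quat) \<Rightarrow> quat \<Rightarrow> 'v \<Rightarrow> quat" where
  "dual_scale L f a = (\<lambda>y\<in>vecs L. qcnj a * f y)"

definition to_dual :: "'v herm_module \<Rightarrow> 'v \<Rightarrow> 'v \<Rightarrow> quat" where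
  "to_dual L x = (\<lambda>y\<in>vecs L. form L x y)"

text \<open>The equality \<open>p L' = L\<close>, with \<open>L\<close> identified with its image in \<open>L'\<close>.\<close>

definition p_modular :: "quat set \<Rightarrow> quat \<Rightarrow> 'v herm_module \<Rightarrow> bool" where
  "p_modular \<O> p L \<longleftrightarrow> (\<lambda>f. dual_scale L f p) ` dual \<O> L = to_dual L ` vecs L"

section \<open>The lattice of the projective plane\<close>

text \<open>
  Points and lines of the projective plane over a finite field are the subspaces of dimension
  1 and 2 of its third power; incidence is inclusion.
\<close>

definition proj_points :: "('f::{field,finite}^3) set set" where
  "proj_points = {S. vec.subspace S \<and> vec.dim S = 1}"

definition proj_lines :: "('f::{field,finite}^3) set set" where
  "proj_lines = {S. vec.subspace S \<and> vec.dim S = 2}"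

definition plane_gram ::
    "quat \<Rightarrow> nat \<Rightarrow> ('f::{field,finite}^3) set \<Rightarrow> ('f^3) set \<Rightarrow> quat" where
  "plane_gram p q r s =
     (if r = s then - of_nat q
      else if r \<in> proj_points \<and> s \<in> proj_lines \<and> r \<subseteq> s then p
      else if r \<in> proj_lines \<and> s \<in> proj_points \<and> s \<subseteq> r then qcnj p
      else 0)"

definition plane_lattice0 ::
    "quat set \<Rightarrow> quat \<Rightarrow> nat \<Rightarrow> (('f::{field,finite}^3) set \<Rightarrow> quat) herm_module" where
  "plane_lattice0 \<O> p q = free_herm_module \<O> (proj_points \<union> proj_lines) (plane_gram p q)"

definition plane_lattice ::
    "quat set \<Rightarrow> quat \<Rightarrow> nat \<Rightarrow> (('f::{field,finite}^3) set \<Rightarrow> quat) set herm_module" where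
  "plane_lattice \<O> p q = mod_radical (plane_lattice0 \<O> p q)"

end

(*
  Let phi be the values on the basis of a functional f killing the radical, N the incidence matrix.
  Representing conj(p) f by a vector (a, b) amounts to N b - conj(p) a = c and N^T a - p b = d for
  integral c, d determined by phi. The vectors with entry 1 at the points of a line l and conj(p)
  at l differ by elements of the radical; testing phi on these differences gives that
  N^T c + conj(p) d is constant. So modulo p the function c on the points of the projective plane
  has constant line sums.

  For prime q such a function is a combination of indicators of lines. The line with normal w has
  indicator 1 - (w.v)^(q-1), and the powers (w.v)^(q-1) span all forms of degree q - 1, because the
  multinomial coefficients involved are invertible. After subtracting a constant, the function is
  scaling invariant and orthogonal to all these forms, and interpolation shows that it is itself a
  form of degree q - 1. Hence N b = c is solvable modulo p; N^T N = q + J then forces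
  the equations of the lines to hold up to one common error, which can be removed.
*)
theory Submission
  imports Defs "HOL-Number_Theory.Residues"
begin

section \<open>Power sums over a finite field\<close>

text \<open>One inclusion is cheap: every Gram entry lies in \<open>p\<O>\<close>, so L_q lies in p
  L_q'. The converse asks to solve a singular Gram system, whose right-hand side must respect the
  whole radical; testing it on differences of line vectors turns out to suffice. Behind this is a
  fact about codes. Modulo p the lines span a code C inside the functions with constant line sums,
  because two distinct lines share one point and q + 1 is congruent to 1. For prime q equality
  holds, and C has dimension (q^2 + q + 2) / 2; for proper prime powers C is smaller, since some
  multinomial coefficients vanish. Instead of comparing dimensions, the proof produces the
  coefficients: functions on points become scaling invariant functions on the vector space, where
  power sums carry out the interpolation.\<close>

lemma of_nat_card_field: "of_nat CARD('f::{field,finite}) = (0::'f)"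
  using CHAR_dvd_CARD[where 'a='f] by (simp add: of_nat_eq_0_iff_char_dvd)

lemma card_field_gt_1: "CARD('f::{field,finite}) > 1"
proof -
  have "card {0::'f, 1} \<le> CARD('f)" by (intro card_mono) auto
  then show ?thesis by simp
qed

lemma of_nat_card_minus_1: "of_nat (CARD('f) - 1) = (-1::'f::{field,finite})"
  using card_field_gt_1[where 'f='f] by (simp add: of_nat_diff of_nat_card_field)

lemma power_card_minus_1:
  fixes x :: "'f::{field,finite}"
  assumes "x \<noteq> 0"
  shows "x ^ (CARD('f) - 1) = 1"
proof -
  have "(\<Prod>y\<in>UNIV - {0}. y) = (\<Prod>y\<in>UNIV - {0}. x * y)"
    using assms by (intro prod.reindex_bij_witness[of _ "\<lambda>y. x * y" "\<lambda>y. y / x"]) auto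
  also have "\<dots> = x ^ (CARD('f) - 1) * (\<Prod>y\<in>UNIV - {0}. y)"
    by (simp add: prod.distrib card_Diff_singleton)
  finally have "(\<Prod>y\<in>UNIV - {0}. y) * (x ^ (CARD('f) - 1) - 1) = (0::'f)"
    by (simp add: algebra_simps)
  then show ?thesis by simp
qed

text \<open>Simplification turns \<open>CARD('f) - 1\<close> into \<open>CARD('f) - Suc 0\<close>;
  this version matches the result.\<close>

lemmas power_card_minus_Suc_0 = power_card_minus_1[unfolded One_nat_def]

lemma power_card:
  fixes x :: "'f::{field,finite}"
  shows "x ^ CARD('f) = x"
proof (cases "x = 0")
  case False
  have "x ^ CARD('f) = x * x ^ (CARD('f) - 1)"
    using card_field_gt_1[where 'f='f] by (cases "CARD('f)") auto
  then show ?thesis using False by (simp add: power_card_minus_Suc_0)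
qed simp

lemma power_card_minus_1_eq:
  fixes x :: "'f::{field,finite}"
  shows "x ^ (CARD('f) - 1) = (if x = 0 then 0 else 1)"
  using card_field_gt_1[where 'f='f] by (simp add: power_card_minus_Suc_0 zero_power)

text \<open>On nonzero elements the exponent may be reduced modulo q - 1 to some k with 0 < k < q -
  1, and X^k - 1 has fewer roots than there are nonzero elements.\<close>

lemma ex_power_neq_1:
  assumes "\<not> (CARD('f::{field,finite}) - 1) dvd m"
  obtains x :: "'f::{field,finite}" where "x \<noteq> 0" "x ^ m \<noteq> 1"
proof -
  define k where "k = m mod (CARD('f) - 1)"
  have k: "0 < k" "k < CARD('f) - 1"
    using assms card_field_gt_1[where 'f='f] by (auto simp: k_def mod_greater_zero_iff_not_dvd)
  have red: "x ^ m = x ^ k" if "x \<noteq> 0" for x :: 'f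
  proof -
    have "x ^ m = x ^ ((CARD('f) - 1) * (m div (CARD('f) - 1)) + k)"
      unfolding k_def by simp
    also have "\<dots> = x ^ k"
      using that by (simp only: power_add power_mult power_card_minus_1[OF that] power_one mult_1)
    finally show ?thesis .
  qed
  have "\<exists>x::'f. x \<noteq> 0 \<and> x ^ m \<noteq> 1"
  proof (rule ccontr)
    assume *: "\<not> ?thesis"
    define P where "P = Polynomial.monom (1::'f) k - 1"
    have "Polynomial.coeff P k = 1" using k by (simp add: P_def)
    then have "P \<noteq> 0" by auto
    have "Polynomial.degree P \<le> k"
      unfolding P_def by (rule degree_diff_le) (auto simp: degree_monom_le)
    have "UNIV - {0::'f} \<subseteq> {x. poly P x = 0}"
      using * red by (auto simp: P_def poly_monom)
    then have "card (UNIV - {0::'f}) \<le> card {x. poly P x = 0}"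
      by (intro card_mono) auto
    also have "\<dots> \<le> Polynomial.degree P"
      using \<open>P \<noteq> 0\<close> by (rule card_poly_roots_bound)
    finally show False
      using k \<open>Polynomial.degree P \<le> k\<close> by (simp add: card_Diff_singleton)
  qed
  then show ?thesis using that by blast
qed

text \<open>Substituting y x for x multiplies the sum by y^m, which kills it as soon as some nonzero
  y has y^m different from 1. Otherwise the terms are explicit: for m > 0 the q - 1 nonzero elements
  contribute 1 each, and for m = 0 all q elements do, as 0^0 = 1.\<close>

lemma sum_power_field:
  "(\<Sum>x\<in>UNIV. (x::'f::{field,finite}) ^ m) = (if m > 0 \<and> (CARD('f::{field,finite}) - 1) dvd m then -1 else 0)"
proof (cases "m > 0 \<and> (CARD('f) - 1) dvd m")
  case True
  then obtain k where k: "m = (CARD('f) - 1) * k" by blast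
  have "x ^ m = (if x = 0 then 0 else 1)" for x :: 'f
    using True by (auto simp: k power_mult power_card_minus_Suc_0)
  then have "(\<Sum>x\<in>UNIV. (x::'f) ^ m) = (\<Sum>x\<in>UNIV. if x = (0::'f) then 0 else (1::'f))" by simp
  also have "\<dots> = of_nat (card (UNIV - {0::'f}))"
    by (simp add: sum.If_cases Compl_eq_Diff_UNIV)
  also have "\<dots> = -1" by (simp only: card_Diff_singleton[OF UNIV_I] of_nat_card_minus_1)
  finally show ?thesis using True by simp
next
  case False
  have "(\<Sum>x\<in>UNIV. (x::'f) ^ m) = 0"
  proof (cases "m = 0")
    case True
    then show ?thesis by (simp add: of_nat_card_field)
  next
    case m: False
    then obtain y :: 'f where y: "y \<noteq> 0" "y ^ m \<noteq> 1"
      using ex_power_neq_1[of m] False by blast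
    have "(\<Sum>x\<in>UNIV. (x::'f) ^ m) = (\<Sum>x\<in>UNIV. (y * x) ^ m)"
      using y by (intro sum.reindex_bij_witness[of _ "\<lambda>x. y * x" "\<lambda>x. x / y"]) auto
    also have "\<dots> = y ^ m * (\<Sum>x\<in>UNIV. x ^ m)"
      by (simp add: power_mult_distrib sum_distrib_left)
    finally have "(1 - y ^ m) * (\<Sum>x\<in>UNIV. (x::'f) ^ m) = 0"
      by (simp add: algebra_simps)
    then show ?thesis using y by simp
  qed
  then show ?thesis using False by simp
qed

text \<open>Primality of the field size enters here: it makes the characteristic equal to q, which
  cannot divide n! for n < q.\<close>

lemma of_nat_binomial_neq_0:
  assumes "Factorial_Ring.prime CARD('f::{field,finite})" "n < CARD('f)" "k \<le> n"
  shows "of_nat (n choose k) \<noteq> (0::'f::{field,finite})"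
proof
  assume *: "of_nat (n choose k) = (0::'f)"
  have "CHAR('f) dvd CARD('f)" by (rule CHAR_dvd_CARD)
  then have "CHAR('f) = CARD('f)"
    using assms(1) CHAR_not_1'[where 'a='f] unfolding prime_nat_iff by force
  then have "CARD('f) dvd (n choose k)"
    using * by (simp add: of_nat_eq_0_iff_char_dvd)
  then have "CARD('f) dvd fact n"
    using binomial_fact_lemma[OF \<open>k \<le> n\<close>] by (metis dvd_mult)
  then show False
    using assms by (simp add: prime_dvd_fact_iff)
qed

text \<open>The geometric sum times x - u is x^q - u^q = x - u; for x = u it consists of q equal
  terms and vanishes.\<close>

lemma delta_field:
  fixes x u :: "'f::{field,finite}"
  shows "1 - (\<Sum>i<CARD('f). x ^ i * u ^ (CARD('f) - 1 - i)) = (if x = u then 1 else 0)"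
proof (cases "x = u")
  case True
  have "(\<Sum>i<CARD('f). u ^ i * u ^ (CARD('f) - 1 - i)) = (\<Sum>i<CARD('f). u ^ (CARD('f) - 1))"
    by (intro sum.cong) (auto simp flip: power_add)
  then show ?thesis using True by (simp add: of_nat_card_field)
next
  case False
  have "(x - u) * (\<Sum>i<CARD('f). x ^ i * u ^ (CARD('f) - 1 - i)) = x ^ CARD('f) - u ^ CARD('f)"
    using power_diff_sumr2[of x "CARD('f)" u] by (simp add: mult.commute)
  then show ?thesis using False by (simp add: power_card)
qed

section \<open>Functions on a three-dimensional space\<close>

definition vdot :: "'f::comm_ring_1^'n \<Rightarrow> 'f^'n \<Rightarrow> 'f" where
  "vdot w v = (\<Sum>i\<in>UNIV. w $ i * v $ i)"

lemma vdot_commute: "vdot w v = vdot v w"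
  by (simp add: vdot_def mult.commute)

lemma vdot_add: "vdot w (u + v) = vdot w u + vdot w v"
  by (simp add: vdot_def algebra_simps sum.distrib)

lemma vdot_diff: "vdot w (u - v) = vdot w u - vdot w v"
  by (simp add: vdot_def algebra_simps sum_subtractf)

lemma vdot_smult: "vdot w (c *s v) = c * vdot w v"
  by (simp add: vdot_def sum_distrib_left mult_ac)

lemma vdot_0 [simp]: "vdot w 0 = 0" "vdot 0 w = 0"
  by (simp_all add: vdot_def)

lemma vdot_axis [simp]: "vdot w (axis i c) = w $ i * c"
  by (simp add: vdot_def axis_def if_distrib cong: if_cong)

text \<open>Translation along an axis on which v has a nonzero coordinate carries every fibre of the
  linear map onto its kernel. The product form avoids a subtraction in the exponent.\<close>

lemma card_vdot_eq_0:
  fixes v :: "'f::{field,finite}^'n"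
  assumes "v \<noteq> 0"
  shows "card {w. vdot w v = 0} * CARD('f) = CARD('f) ^ CARD('n)"
proof -
  obtain i where i: "v $ i \<noteq> 0" using assms by (auto simp: vec_eq_iff)
  have fib: "card {w. vdot v w = y} = card {w. vdot v w = 0}" for y
  proof (rule bij_betw_same_card[of "\<lambda>w. w - axis i (y / v $ i)"])
    show "bij_betw (\<lambda>w. w - axis i (y / v $ i)) {w. vdot v w = y} {w. vdot v w = 0}"
      by (rule bij_betw_byWitness[where f' = "\<lambda>w. w + axis i (y / v $ i)"])
        (use i in \<open>auto simp: vdot_add vdot_diff\<close>)
  qed
  have "CARD('f^'n) = card (\<Union>y. {w. vdot v w = y})"
    by (intro arg_cong[where f = card]) auto
  also have "\<dots> = (\<Sum>y\<in>UNIV. card {w. vdot v w = y})"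
    by (intro card_UN_disjoint) auto
  also have "\<dots> = (\<Sum>y\<in>(UNIV::'f set). card {w. vdot v w = 0})"
    by (intro sum.cong refl fib)
  finally show ?thesis by (simp add: mult.commute vdot_commute[of v])
qed

lemma card_perp:
  fixes v :: "'f::{field,finite}^3"
  assumes "v \<noteq> 0"
  shows "card {w. vdot w v = 0} = CARD('f) ^ 2"
  using card_vdot_eq_0[OF assms] card_field_gt_1[where 'f='f]
  by (simp add: power2_eq_square power3_eq_cube)

section \<open>The span of the powers of linear forms\<close>

text \<open>Each power is 0 or 1, so this is also the span of the indicators of complements of
  planes through the origin; w = 0 contributes the zero function.\<close>

definition form_span :: "('f::{field,finite}^3 \<Rightarrow> 'f) set" where
  "form_span = {f. \<exists>\<beta>. \<forall>u. f u = (\<Sum>w\<in>UNIV. \<beta> w * vdot w u ^ (CARD('f) - 1))}"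

lemma form_span_base: "(\<lambda>u. vdot w u ^ (CARD('f) - 1)) \<in> form_span"
  for w :: "'f::{field,finite}^3"
  unfolding form_span_def
  by (intro CollectI exI[of _ "\<lambda>x. if x = w then 1 else 0"])
    (simp add: if_distrib[of "\<lambda>x. x * _"] cong: if_cong)

lemma form_span_scale:
  fixes f :: "'f::{field,finite}^3 \<Rightarrow> 'f"
  shows "f \<in> form_span \<Longrightarrow> (\<lambda>u. c * f u) \<in> form_span"
proof -
  assume "f \<in> form_span"
  then obtain \<beta> where \<beta>: "\<And>u. f u = (\<Sum>w\<in>UNIV. \<beta> w * vdot w u ^ (CARD('f) - 1))"
    by (auto simp: form_span_def)
  show ?thesis
    unfolding form_span_def
    by (intro CollectI exI[of _ "\<lambda>w. c * \<beta> w"]) (simp add: \<beta> sum_distrib_left mult.assoc)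
qed

lemma form_span_add:
  fixes f :: "'f::{field,finite}^3 \<Rightarrow> 'f"
  shows "f \<in> form_span \<Longrightarrow> g \<in> form_span \<Longrightarrow> (\<lambda>u. f u + g u) \<in> form_span"
proof -
  assume "f \<in> form_span" "g \<in> form_span"
  then obtain \<beta> \<gamma> where \<beta>: "\<And>u. f u = (\<Sum>w\<in>UNIV. \<beta> w * vdot w u ^ (CARD('f) - 1))"
    and \<gamma>: "\<And>u. g u = (\<Sum>w\<in>UNIV. \<gamma> w * vdot w u ^ (CARD('f) - 1))"
    by (auto simp: form_span_def)
  show ?thesis
    unfolding form_span_def
    by (intro CollectI exI[of _ "\<lambda>w. \<beta> w + \<gamma> w"]) (simp add: \<beta> \<gamma> sum.distrib algebra_simps)
qed

lemma form_span_sum: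
  fixes f :: "'b \<Rightarrow> 'f::{field,finite}^3 \<Rightarrow> 'f"
  assumes "\<And>x. x \<in> A \<Longrightarrow> f x \<in> form_span"
  shows "(\<lambda>u. \<Sum>x\<in>A. f x u) \<in> form_span"
  using assms
proof (induction A rule: infinite_finite_induct)
  case (insert x A)
  then show ?case by (simp add: form_span_add)
qed (auto simp: form_span_def intro!: exI[of _ "\<lambda>_. 0"])

text \<open>
  The power sums over the field invert the Vandermonde system given by all values of \<open>t\<close>.
\<close>

lemma form_span_coeff:
  fixes f :: "nat \<Rightarrow> 'f::{field,finite}^3 \<Rightarrow> 'f"
  assumes mem: "\<And>t. (\<lambda>u. \<Sum>j\<le>n. t ^ j * f j u) \<in> form_span"
    and n: "n < CARD('f)" and i: "i \<le> n"
  shows "f i \<in> form_span"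
\<comment> \<open>Power sums cannot isolate i = 0: for n = q - 1 both j = 0 and j = q - 1 would
  survive. Evaluation at t = 0 does it instead.\<close>
proof (cases "i = 0")
  case True
  have "(\<Sum>j\<le>n. 0 ^ j * f j u) = f 0 u" for u
    by (subst sum.remove[of _ 0]) (auto simp: power_0_left intro!: sum.neutral)
  then show ?thesis using mem[of 0] True by simp
next
  case False
  have eq: "(\<Sum>t\<in>UNIV. t ^ (CARD('f) - 1 - i) * (\<Sum>j\<le>n. t ^ j * f j u)) = - f i u" for u
  proof -
    have "(\<Sum>t\<in>UNIV. t ^ (CARD('f) - 1 - i) * (\<Sum>j\<le>n. t ^ j * f j u)) =
        (\<Sum>j\<le>n. (\<Sum>t\<in>UNIV. t ^ (CARD('f) - 1 - i + j)) * f j u)"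
      by (simp add: sum_distrib_left sum_distrib_right power_add mult.assoc)
        (rule sum.swap)
    also have "\<dots> = (\<Sum>j\<le>n. if j = i then - f i u else 0)"
    proof (intro sum.cong refl)
      fix j assume j: "j \<in> {..n}"
      \<comment> \<open>As i > 0, the exponent stays below 2 (q - 1). Exponent 0, which occurs for i
        = q - 1 and j = 0, is harmless because the sum of all t^0 vanishes.\<close>
      have "(CARD('f) - 1 - i + j > 0 \<and> (CARD('f) - 1) dvd (CARD('f) - 1 - i + j)) \<longleftrightarrow> j = i"
      proof
        assume *: "CARD('f) - 1 - i + j > 0 \<and> (CARD('f) - 1) dvd (CARD('f) - 1 - i + j)"
        then obtain k where k: "CARD('f) - 1 - i + j = (CARD('f) - 1) * k" by blast
        have "(CARD('f) - 1) * k < (CARD('f) - 1) * 2"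
          unfolding k[symmetric] using j i n False by auto
        then have "k < 2" by simp
        moreover have "k \<noteq> 0" using * k by (metis less_not_refl mult_0_right)
        ultimately have "k = 1" by simp
        then show "j = i" using k i n by simp
      next
        assume "j = i"
        then show "CARD('f) - 1 - i + j > 0 \<and> (CARD('f) - 1) dvd (CARD('f) - 1 - i + j)"
          using i n False by auto
      qed
      then show "(\<Sum>t\<in>UNIV. t ^ (CARD('f) - 1 - i + j)) * f j u = (if j = i then - f i u else 0)"
        by (simp only: sum_power_field) simp
    qed
    also have "\<dots> = - f i u" using i by simp
    finally show ?thesis .
  qed
  have "(\<lambda>u. \<Sum>t\<in>UNIV. t ^ (CARD('f) - 1 - i) * (\<Sum>j\<le>n. t ^ j * f j u)) \<in> form_span"
    by (intro form_span_sum form_span_scale mem)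
  then have "(\<lambda>u. - f i u) \<in> form_span" by (simp only: eq)
  from form_span_scale[OF this, of "-1"] show ?thesis by simp
qed

text \<open>The linear forms u1 + t (u2 + r u3) suffice. Extracting a power of t separates u1 from
  the other coordinates, and extracting a power of r then separates u2 from u3. What remains is the
  monomial times two binomial coefficients, invertible because q is prime.\<close>

lemma monomial_in_form_span:
  assumes q: "Factorial_Ring.prime CARD('f::{field,finite})"
    and e: "e1 + e2 + e3 = CARD('f) - 1"
  shows "(\<lambda>u::'f::{field,finite}^3. u $ 1 ^ e1 * u $ 2 ^ e2 * u $ 3 ^ e3) \<in> form_span"
proof -
  let ?n = "CARD('f) - 1"
  have lt: "?n < CARD('f)" by simp
  have vd: "vdot (vector [1, t, t * r]) u = u $ 1 + t * (u $ 2 + r * u $ 3)"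
    for t r and u :: "'f^3"
    by (simp add: vdot_def sum_3 vector_3 algebra_simps)
  have pow: "(a + t * b) ^ m = (\<Sum>j\<le>m. t ^ j * (of_nat (m choose j) * a ^ (m - j) * b ^ j))"
    for a t b :: 'f and m
    by (subst add.commute, subst binomial_ring)
      (auto intro!: sum.cong simp: power_mult_distrib mult_ac)
  have 1: "(\<lambda>u. of_nat (?n choose i) * u $ 1 ^ (?n - i) * (u $ 2 + r * u $ 3) ^ i) \<in> form_span"
    if "i \<le> ?n" for i and r :: 'f
  proof (rule form_span_coeff[OF _ lt that])
    fix t :: 'f
    show "(\<lambda>u. \<Sum>j\<le>?n. t ^ j * (of_nat (?n choose j) * u $ 1 ^ (?n - j) *
        (u $ 2 + r * u $ 3) ^ j)) \<in> form_span"
      using form_span_base[of "vector [1, t, t * r]"] by (simp only: vd pow)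
  qed
  have 2: "(\<lambda>u::'f^3. of_nat (i choose j) * (u $ 2 ^ (i - j) * u $ 3 ^ j) *
      (of_nat (?n choose i) * u $ 1 ^ (?n - i))) \<in> form_span"
    if "i \<le> ?n" "j \<le> i" for i j
  proof (rule form_span_coeff[where n = i and i = j and f = "\<lambda>j u. of_nat (i choose j) *
      (u $ 2 ^ (i - j) * u $ 3 ^ j) * (of_nat (?n choose i) * u $ 1 ^ (?n - i))"])
    fix t :: 'f
    have "(\<lambda>u::'f^3. of_nat (?n choose i) * u $ 1 ^ (?n - i) * (u $ 2 + t * u $ 3) ^ i) =
      (\<lambda>u::'f^3. \<Sum>j\<le>i. t ^ j * (of_nat (i choose j) * (u $ 2 ^ (i - j) * u $ 3 ^ j) *
        (of_nat (?n choose i) * u $ 1 ^ (?n - i))))"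
      by (simp add: pow sum_distrib_left mult_ac)
    with 1[OF that(1), of t]
    show "(\<lambda>u. \<Sum>j\<le>i. t ^ j * (of_nat (i choose j) * (u $ 2 ^ (i - j) * u $ 3 ^ j) *
        (of_nat (?n choose i) * u $ 1 ^ (?n - i)))) \<in> form_span" by simp
  qed (use that lt in linarith)+
  have ne: "of_nat ((e2 + e3) choose e3) \<noteq> (0::'f)" "of_nat (?n choose (e2 + e3)) \<noteq> (0::'f)"
    by (rule of_nat_binomial_neq_0[OF q]; use e lt in linarith)+
  have "?n - (e2 + e3) = e1" "e2 + e3 - e3 = e2" "e2 + e3 \<le> ?n" using e by auto
  with 2[of "e2 + e3" e3] ne
  have "(\<lambda>u::'f^3. inverse (of_nat ((e2 + e3) choose e3) * of_nat (?n choose (e2 + e3))) *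
      (of_nat ((e2 + e3) choose e3) * (u $ 2 ^ e2 * u $ 3 ^ e3) *
      (of_nat (?n choose (e2 + e3)) * u $ 1 ^ e1))) \<in> form_span"
    by (intro form_span_scale) simp
  then show ?thesis using ne by (simp add: field_simps)
qed

section \<open>Moments and interpolation of functions on the vector space\<close>

definition moment :: "('f::field^3 \<Rightarrow> 'f) \<Rightarrow> nat \<Rightarrow> nat \<Rightarrow> nat \<Rightarrow> 'f" where
  "moment \<phi> e1 e2 e3 = (\<Sum>u\<in>UNIV. \<phi> u * (u $ 1 ^ e1 * u $ 2 ^ e2 * u $ 3 ^ e3))"

text \<open>Scaling the variable by c multiplies the moment by c raised to the total degree, and
  some nonzero c makes that factor differ from 1.\<close>

lemma moment_eq_0_of_not_dvd:
  fixes \<phi> :: "'f::{field,finite}^3 \<Rightarrow> 'f"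
  assumes hom: "\<And>c v. c \<noteq> 0 \<Longrightarrow> \<phi> (c *s v) = \<phi> v"
    and nd: "\<not> (CARD('f) - 1) dvd (e1 + e2 + e3)"
  shows "moment \<phi> e1 e2 e3 = 0"
proof -
  obtain c :: 'f where c: "c \<noteq> 0" "c ^ (e1 + e2 + e3) \<noteq> 1"
    using ex_power_neq_1[OF nd] by blast
  have "moment \<phi> e1 e2 e3 =
      (\<Sum>u\<in>UNIV. \<phi> (c *s u) * ((c *s u) $ 1 ^ e1 * (c *s u) $ 2 ^ e2 * (c *s u) $ 3 ^ e3))"
    unfolding moment_def using c
    by (intro sum.reindex_bij_witness[of _ "\<lambda>u. c *s u" "\<lambda>u. inverse c *s u"])
      (auto simp: vec.scale_scale)
  also have "\<dots> = c ^ (e1 + e2 + e3) * moment \<phi> e1 e2 e3"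
    unfolding moment_def using c
    by (simp add: hom power_mult_distrib power_add sum_distrib_left mult_ac)
  finally have "(1 - c ^ (e1 + e2 + e3)) * moment \<phi> e1 e2 e3 = 0"
    by (simp add: algebra_simps)
  then show ?thesis using c by simp
qed

lemma sum_product3:
  fixes f :: "'a \<Rightarrow> 'r::comm_semiring_0"
  shows "sum f A * sum g B * sum h C = (\<Sum>(i, j, k)\<in>A \<times> B \<times> C. f i * g j * h k)"
proof -
  have "sum f A * sum g B * sum h C = (\<Sum>i\<in>A. f i * (sum g B * sum h C))"
    by (simp add: sum_distrib_right mult.assoc)
  also have "sum g B * sum h C = (\<Sum>(j, k)\<in>B \<times> C. g j * h k)"
    by (simp add: sum_product sum.cartesian_product)
  also have "(\<Sum>i\<in>A. f i * \<dots>) = (\<Sum>i\<in>A. \<Sum>(j, k)\<in>B \<times> C. f i * (g j * h k))"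
    by (simp add: sum_distrib_left split_def)
  also have "\<dots> = (\<Sum>(i, j, k)\<in>A \<times> B \<times> C. f i * g j * h k)"
    by (simp add: sum.cartesian_product split_def mult.assoc)
  finally show ?thesis .
qed

text \<open>
  The coefficients, as polynomials in \<open>x\<close>, of the powers \<open>y ^ i\<close> in the polynomial of degree
  less than \<open>q\<close> in \<open>y\<close> that represents the indicator of \<open>y = x\<close>.
\<close>

definition delta_coeff :: "nat \<Rightarrow> nat \<Rightarrow> 'f::{field,finite}" where
  "delta_coeff i e = (if i = 0 \<and> e = 0 then 1 else 0) - (if e = CARD('f) - 1 - i then 1 else 0)"

text \<open>This is \<open>delta_field\<close> sorted by powers of y: the inner sum equals - x^(q -
  1 - i), plus 1 if i = 0. Cutting it off at e = q - 1 - i records that i + e never exceeds q - 1, a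
  bound on which the later degree count rests.\<close>

lemma delta_eq_sum:
  fixes x y :: "'f::{field,finite}"
  shows "(\<Sum>i<CARD('f). y ^ i * (\<Sum>e\<le>CARD('f) - 1 - i. delta_coeff i e * x ^ e)) =
    (if y = x then 1 else 0)"
proof -
  let ?q = "CARD('f)"
  have "(\<Sum>e\<le>?q - 1 - i. delta_coeff i e * x ^ e) = (if i = 0 then 1 else 0) - x ^ (?q - 1 - i)" for i
  proof -
    have "(\<Sum>e\<le>?q - 1 - i. delta_coeff i e * x ^ e) =
      (\<Sum>e\<le>?q - 1 - i. (if e = 0 then (if i = 0 then 1 else 0) else 0) -
         (if e = ?q - 1 - i then x ^ (?q - 1 - i) else 0))"
      unfolding delta_coeff_def by (intro sum.cong) auto
    also have "\<dots> = (if i = 0 then 1 else 0) - x ^ (?q - 1 - i)"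
      by (subst sum_subtractf) (simp add: sum.delta)
    finally show ?thesis .
  qed
  then have "(\<Sum>i<?q. y ^ i * (\<Sum>e\<le>?q - 1 - i. delta_coeff i e * x ^ e)) =
      (\<Sum>i<?q. (if i = 0 then 1 else 0) - y ^ i * x ^ (?q - 1 - i))"
    by (intro sum.cong) (auto simp: right_diff_distrib)
  also have "\<dots> = 1 - (\<Sum>i<?q. y ^ i * x ^ (?q - 1 - i))"
    by (subst sum_subtractf) (simp add: sum.delta)
  finally show ?thesis by (simp only: delta_field)
qed

text \<open>Every coefficient of the interpolating polynomial is a combination of moments. A moment
  occurring in the coefficient of v1^i v2^j v3^k has total degree congruent to -(i + j + k) modulo q
  - 1, and the two degrees add up to at most 3 (q - 1). Nonzero moments have degree at least 2 (q -
  1), which leaves only i + j + k = 0 or q - 1; the constant term dies because \<open>\<phi>\<close>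
  vanishes at 0.\<close>

lemma homogeneous_in_form_span:
  fixes \<phi> :: "'f::{field,finite}^3 \<Rightarrow> 'f"
  assumes q: "Factorial_Ring.prime CARD('f)"
    and hom: "\<And>c v. c \<noteq> 0 \<Longrightarrow> \<phi> (c *s v) = \<phi> v" and 0: "\<phi> 0 = 0"
    and mom: "\<And>e1 e2 e3. e1 + e2 + e3 = 0 \<or> e1 + e2 + e3 = CARD('f) - 1 \<Longrightarrow> moment \<phi> e1 e2 e3 = 0"
  shows "\<phi> \<in> form_span"
proof -
  let ?n = "CARD('f) - 1" and ?I = "{..<CARD('f)}"
  define G :: "nat \<Rightarrow> 'f \<Rightarrow> 'f" where "G i x = (\<Sum>e\<le>?n - i. delta_coeff i e * x ^ e)" for i x
  define m where "m i j k = (\<Sum>u\<in>UNIV. \<phi> u * (G i (u $ 1) * G j (u $ 2) * G k (u $ 3)))" for i j k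
  have delta: "(\<Sum>i\<in>?I. y ^ i * G i x) = (if y = x then 1 else 0)" for x y
    unfolding G_def by (rule delta_eq_sum)
  have expand: "\<phi> v = (\<Sum>(i, j, k)\<in>?I \<times> ?I \<times> ?I. m i j k * (v $ 1 ^ i * v $ 2 ^ j * v $ 3 ^ k))" for v
  proof -
    have "\<phi> v = (\<Sum>u\<in>UNIV. if u = v then \<phi> u else 0)" by simp
    also have "\<dots> = (\<Sum>u\<in>UNIV. \<phi> u * ((\<Sum>i\<in>?I. (v $ 1) ^ i * G i (u $ 1)) *
        (\<Sum>i\<in>?I. (v $ 2) ^ i * G i (u $ 2)) * (\<Sum>i\<in>?I. (v $ 3) ^ i * G i (u $ 3))))"
      by (intro sum.cong) (auto simp: delta vec_eq_iff forall_3)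
    also have "\<dots> = (\<Sum>(i, j, k)\<in>?I \<times> ?I \<times> ?I. m i j k * (v $ 1 ^ i * v $ 2 ^ j * v $ 3 ^ k))"
      unfolding sum_product3
      unfolding m_def sum_distrib_left sum_distrib_right split_def
      by (subst sum.swap) (simp add: mult_ac)
    finally show ?thesis .
  qed
  have m_moment: "m i j k = (\<Sum>(e1, e2, e3)\<in>{..?n - i} \<times> {..?n - j} \<times> {..?n - k}.
      delta_coeff i e1 * delta_coeff j e2 * delta_coeff k e3 * moment \<phi> e1 e2 e3)" for i j k
    unfolding m_def G_def sum_product3
    unfolding moment_def sum_distrib_left sum_distrib_right split_def
    by (subst sum.swap) (simp add: mult_ac)
  have m0: "m i j k = 0" if ijk: "i \<le> ?n" "j \<le> ?n" "k \<le> ?n" and d: "i + j + k \<noteq> 0" "i + j + k \<noteq> ?n"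
    for i j k
    unfolding m_moment
  proof (intro sum.neutral ballI)
    fix t assume "t \<in> {..?n - i} \<times> {..?n - j} \<times> {..?n - k}"
    then obtain e1 e2 e3 where t: "t = (e1, e2, e3)"
      and e: "e1 \<in> {..?n - i}" "e2 \<in> {..?n - j}" "e3 \<in> {..?n - k}" by auto
    have dv: "?n dvd i + e" if "delta_coeff i e \<noteq> (0::'f)" "i \<le> ?n" for i e
      using that by (auto simp: delta_coeff_def split: if_splits)
    have "delta_coeff i e1 * delta_coeff j e2 * delta_coeff k e3 * moment \<phi> e1 e2 e3 = 0"
    proof (rule ccontr)
      assume nz: "\<not> ?thesis"
      then have "?n dvd (i + e1) + (j + e2) + (k + e3)"
        using dv[of i e1] dv[of j e2] dv[of k e3] ijk by simp
      then have sum: "?n dvd (e1 + e2 + e3) + (i + j + k)" by (simp add: add_ac)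
      have s: "?n dvd e1 + e2 + e3"
        using nz moment_eq_0_of_not_dvd[of \<phi> e1 e2 e3] hom by auto
      then have "?n dvd i + j + k" using sum dvd_add_right_iff by blast
      then obtain a where a: "i + j + k = ?n * a" by blast
      obtain b where b: "e1 + e2 + e3 = ?n * b" using s by blast
      have "a \<ge> 2" using a d by (cases a; cases "a - 1") auto
      have "?n * (a + b) \<le> ?n * 3"
        unfolding distrib_left a[symmetric] b[symmetric] using e ijk by auto
      moreover have "?n > 0" using card_field_gt_1[where 'f='f] by simp
      ultimately have "a + b \<le> 3" by simp
      with \<open>a \<ge> 2\<close> have "b = 0 \<or> b = 1" by auto
      then have "moment \<phi> e1 e2 e3 = 0" using b by (intro mom) auto
      then show False using nz by simp
    qed
    then show "(case t of (e1, e2, e3) \<Rightarrow> delta_coeff i e1 * delta_coeff j e2 * delta_coeff k e3 *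
      moment \<phi> e1 e2 e3) = 0" by (simp add: t)
  qed
  have m00: "m 0 0 0 = 0"
  proof -
    have "0 = (\<Sum>(i, j, k)\<in>?I \<times> ?I \<times> ?I. m i j k * (0 ^ i * 0 ^ j * 0 ^ k))"
      using expand[of 0] 0 by simp
    also have "\<dots> = (\<Sum>(i, j, k)\<in>{(0, 0, 0)}. m i j k * (0 ^ i * 0 ^ j * 0 ^ k))"
      by (intro sum.mono_neutral_right) (auto simp: power_0_left split: if_splits)
    finally show ?thesis by simp
  qed
  have "(\<lambda>v. \<Sum>t\<in>?I \<times> ?I \<times> ?I. m (fst t) (fst (snd t)) (snd (snd t)) *
      (v $ 1 ^ fst t * v $ 2 ^ fst (snd t) * v $ 3 ^ snd (snd t))) \<in> form_span"
  proof (rule form_span_sum)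
    fix t assume t: "t \<in> ?I \<times> ?I \<times> ?I"
    obtain i j k where [simp]: "t = (i, j, k)" by (cases t)
    show "(\<lambda>v. m (fst t) (fst (snd t)) (snd (snd t)) *
      (v $ 1 ^ fst t * v $ 2 ^ fst (snd t) * v $ 3 ^ snd (snd t))) \<in> form_span"
    proof (cases "i + j + k = ?n")
      case True
      then show ?thesis using monomial_in_form_span[OF q True] by (simp add: form_span_scale)
    next
      case False
      have "m i j k = 0"
        using t m0[of i j k] m00 False by (cases "i + j + k = 0") auto
      then show ?thesis using form_span_sum[of "{}"] by simp
    qed
  qed
  then show ?thesis by (simp add: expand[abs_def] split_def)
qed

text \<open>Adding the plane sums over all nonzero normals counts each nonzero v exactly q^2 - 1
  times, that is -1 times in the field, so the total of \<open>\<phi>\<close> vanishes. Subtracting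
  a plane sum from the total gives orthogonality to the power belonging to w, and the monomials of
  degree q - 1 are combinations of these powers.\<close>

lemma moment_eq_0_of_plane_sums:
  fixes \<phi> :: "'f::{field,finite}^3 \<Rightarrow> 'f"
  assumes q: "Factorial_Ring.prime CARD('f)"
    and 0: "\<phi> 0 = 0"
    and plane: "\<And>w. w \<noteq> 0 \<Longrightarrow> (\<Sum>v | vdot w v = 0. \<phi> v) = 0"
    and e: "e1 + e2 + e3 = 0 \<or> e1 + e2 + e3 = CARD('f) - 1"
  shows "moment \<phi> e1 e2 e3 = 0"
proof -
  have card0: "of_nat (card {w. vdot w v = 0}) = (0::'f)" if "v \<noteq> 0" for v :: "'f^3"
    using that by (simp add: card_perp of_nat_card_field power2_eq_square)
  have total: "(\<Sum>u\<in>UNIV. \<phi> u) = 0"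
  proof -
    have "0 = (\<Sum>w\<in>UNIV - {0}. \<Sum>v | vdot w v = 0. \<phi> v)"
      by (simp add: plane)
    also have "\<dots> = (\<Sum>w\<in>UNIV. \<Sum>v | vdot w v = 0. \<phi> v) - (\<Sum>u\<in>UNIV. \<phi> u)"
      by (simp add: sum_diff1)
    also have "(\<Sum>w\<in>UNIV. \<Sum>v | vdot w v = 0. \<phi> v) = (\<Sum>v\<in>UNIV. \<Sum>w | vdot w v = 0. \<phi> v)"
      using sum.swap_restrict[of UNIV UNIV "\<lambda>w v. \<phi> v" "\<lambda>w v. vdot w v = 0"] by simp
    also have "\<dots> = (\<Sum>v\<in>UNIV. of_nat (card {w. vdot w v = 0}) * \<phi> v)" by simp
    also have "\<dots> = 0"
    proof (intro sum.neutral ballI)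
      fix v show "of_nat (card {w. vdot w v = 0}) * \<phi> v = 0"
        using 0 card0[of v] by (cases "v = 0") auto
    qed
    finally show ?thesis by simp
  qed
  have pw: "(\<Sum>u\<in>UNIV. \<phi> u * vdot w u ^ (CARD('f) - 1)) = 0" for w
  proof (cases "w = 0")
    case True
    then show ?thesis using card_field_gt_1[where 'f='f] by (simp add: zero_power)
  next
    case False
    have "(\<Sum>u\<in>UNIV. \<phi> u * vdot w u ^ (CARD('f) - 1)) = (\<Sum>u\<in>UNIV. \<phi> u - (if vdot w u = 0 then \<phi> u else 0))"
      unfolding power_card_minus_1_eq by (intro sum.cong) auto
    also have "\<dots> = 0"
      using plane[OF False] total by (simp add: sum_subtractf sum.If_cases)
    finally show ?thesis .
  qed
  show ?thesis
    using e
  proof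
    assume "e1 + e2 + e3 = 0"
    then show ?thesis using total by (simp add: moment_def)
  next
    assume "e1 + e2 + e3 = CARD('f) - 1"
    from monomial_in_form_span[OF q this] obtain \<beta> where \<beta>:
      "\<And>u::'f^3. u $ 1 ^ e1 * u $ 2 ^ e2 * u $ 3 ^ e3 = (\<Sum>w\<in>UNIV. \<beta> w * vdot w u ^ (CARD('f) - 1))"
      by (auto simp: form_span_def)
    have "moment \<phi> e1 e2 e3 = (\<Sum>w\<in>UNIV. \<beta> w * (\<Sum>u\<in>UNIV. \<phi> u * vdot w u ^ (CARD('f) - 1)))"
      unfolding moment_def \<beta> sum_distrib_left
      by (subst sum.swap) (simp add: mult_ac)
    then show ?thesis by (simp only: pw) simp
  qed
qed

section \<open>The projective plane\<close>

lemma card_subspace: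
  fixes S :: "('f::{field,finite}^'n) set"
  assumes "vec.subspace S"
  shows "card S = CARD('f) ^ vec.dim S"
proof -
  obtain B where B: "B \<subseteq> S" "vec.independent B" "S \<subseteq> vec.span B" "card B = vec.dim S"
    using vec.basis_exists by metis
  have S: "S = vec.span B"
    using B assms by (simp add: subset_antisym vec.span_minimal)
  define h where "h = (\<lambda>c. \<Sum>v\<in>B. c v *s v)"
  have inj: "inj_on h (B \<rightarrow>\<^sub>E UNIV)"
  proof (rule inj_onI)
    fix c d assume cd: "c \<in> B \<rightarrow>\<^sub>E UNIV" "d \<in> B \<rightarrow>\<^sub>E UNIV" "h c = h d"
    have "(\<Sum>v\<in>B. (c v - d v) *s v) = 0"
      using cd(3) by (simp add: h_def vec.scale_left_diff_distrib sum_subtractf)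
    then have "c v - d v = 0" if "v \<in> B" for v
      using that conjunct2[OF B(2)[unfolded vec.independent_explicit], rule_format, of "\<lambda>v. c v - d v"]
      by blast
    then show "c = d" using cd by (intro PiE_ext) auto
  qed
  have "h ` (B \<rightarrow>\<^sub>E UNIV) = vec.span B"
  proof -
    have "h c = h (restrict c B)" for c by (simp add: h_def)
    then have "range h = h ` (B \<rightarrow>\<^sub>E UNIV)" by (metis (no_types, lifting) UNIV_I image_iff image_subset_iff
      restrict_PiE_iff subsetI subset_antisym)
    then show ?thesis by (simp add: vec.span_finite h_def)
  qed
  then have "card S = card (B \<rightarrow>\<^sub>E (UNIV :: 'f set))"
    using card_image[OF inj] S by simp
  also have "\<dots> = CARD('f) ^ vec.dim S"
    by (simp add: card_PiE B(4))
  finally show ?thesis .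
qed

lemma span_singleton_in_proj_points: "v \<noteq> 0 \<Longrightarrow> vec.span {v} \<in> proj_points"
  by (simp add: proj_points_def vec.dim_insert)

lemma proj_points_eq_span:
  assumes "s \<in> proj_points" "v \<in> s" "v \<noteq> 0"
  shows "s = vec.span {v}"
proof -
  have "vec.span {v} \<subseteq> s"
    using assms by (intro vec.span_minimal) (auto simp: proj_points_def)
  moreover have "vec.dim (vec.span {v}) = vec.dim s"
    using assms span_singleton_in_proj_points[of v] by (simp add: proj_points_def)
  ultimately show ?thesis
    using assms by (intro vec.subspace_dim_equal[symmetric]) (auto simp: proj_points_def)
qed

lemma proj_points_nonzero:
  assumes "s \<in> proj_points"
  obtains v where "v \<noteq> 0" "s = vec.span {v}"
proof -
  have "\<not> s \<subseteq> {0}"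
    using assms vec.dim_eq_0[of s] by (auto simp: proj_points_def)
  then show ?thesis using that proj_points_eq_span[OF assms] by blast
qed

lemma card_proj_point:
  fixes s :: "('f::{field,finite}^3) set"
  shows "s \<in> proj_points \<Longrightarrow> card s = CARD('f)"
  by (auto simp: proj_points_def card_subspace)

lemma proj_points_subspace: "s \<in> proj_points \<Longrightarrow> vec.subspace s"
  by (simp add: proj_points_def)

lemma proj_lines_subspace: "l \<in> proj_lines \<Longrightarrow> vec.subspace l"
  by (simp add: proj_lines_def)

text \<open>Each point has q - 1 nonzero vectors. The values lie in a general semiring because the
  identity serves both to count points and to sum in the field.\<close>

lemma sum_over_subspace:
  fixes S :: "('f::{field,finite}^3) set" and f :: "('f^3) set \<Rightarrow> 'b::comm_semiring_1"
  assumes S: "vec.subspace S"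
  shows "(\<Sum>v\<in>S - {0}. f (vec.span {v})) =
    of_nat (CARD('f) - 1) * (\<Sum>s | s \<in> proj_points \<and> s \<subseteq> S. f s)"
proof -
  have sub: "vec.span {v} \<subseteq> S" if "v \<in> S" for v
    using that S by (simp add: vec.span_minimal)
  have "(\<Sum>v\<in>S - {0}. f (vec.span {v})) =
      (\<Sum>s | s \<in> proj_points \<and> s \<subseteq> S. \<Sum>v | v \<in> S - {0} \<and> vec.span {v} = s. f (vec.span {v}))"
    using sub by (intro sum.group[symmetric]) (auto intro: span_singleton_in_proj_points)
  also have "\<dots> = (\<Sum>s | s \<in> proj_points \<and> s \<subseteq> S. of_nat (CARD('f) - 1) * f s)"
  proof (intro sum.cong refl)
    fix s assume s: "s \<in> {s. s \<in> proj_points \<and> s \<subseteq> S}"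
    have "{v. v \<in> S - {0} \<and> vec.span {v} = s} = s - {0}"
      using s proj_points_eq_span[of s] vec.span_base[of _ "{_}"] by blast
    moreover have "card (s - {0}) = CARD('f) - 1"
      using s proj_points_subspace vec.subspace_0 by (subst card_Diff_singleton) (auto simp: card_proj_point)
    moreover have "(\<Sum>v | v \<in> S - {0} \<and> vec.span {v} = s. f (vec.span {v})) =
        (\<Sum>v | v \<in> S - {0} \<and> vec.span {v} = s. f s)" by (intro sum.cong) auto
    ultimately show "(\<Sum>v | v \<in> S - {0} \<and> vec.span {v} = s. f (vec.span {v})) = of_nat (CARD('f) - 1) * f s"
      by (simp only: sum_constant)
  qed
  finally show ?thesis by (simp add: sum_distrib_left)
qed

lemma card_points_on_line:
  fixes l :: "('f::{field,finite}^3) set"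
  assumes "l \<in> proj_lines"
  shows "card {s. s \<in> proj_points \<and> s \<subseteq> l} = CARD('f) + 1"
proof -
  have l: "vec.subspace l" "card l = CARD('f) ^ 2"
    using assms by (auto simp: proj_lines_def card_subspace)
  have "(CARD('f) - 1) * card {s. s \<in> proj_points \<and> s \<subseteq> l} = card (l - {0})"
    using sum_over_subspace[OF l(1), of "\<lambda>_. 1::nat"] by simp
  also have "\<dots> = CARD('f) ^ 2 - 1"
    using l vec.subspace_0 by (subst card_Diff_singleton) auto
  also have "\<dots> = (CARD('f) - 1) * (CARD('f) + 1)"
    by (simp add: power2_eq_square algebra_simps)
  finally have "(CARD('f) - 1) * card {s. s \<in> proj_points \<and> s \<subseteq> l} = (CARD('f) - 1) * (CARD('f) + 1)" .
  then show ?thesis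
    using card_field_gt_1[where 'f='f] by (subst (asm) nat_mult_eq_cancel1) simp_all
qed

lemma Int_lines_in_proj_points:
  fixes l m :: "('f::{field,finite}^3) set"
  assumes lm: "l \<in> proj_lines" "m \<in> proj_lines" "l \<noteq> m"
  shows "l \<inter> m \<in> proj_points"
proof -
  have sub: "vec.subspace l" "vec.subspace m" "vec.dim l = 2" "vec.dim m = 2"
    using lm by (auto simp: proj_lines_def)
  have "vec.dim {x + y |x y. x \<in> l \<and> y \<in> m} \<le> 3"
    using vec.dim_subset_UNIV[of "{x + y |x y. x \<in> l \<and> y \<in> m}"] by (simp add: vec.dim_UNIV vec.dimension_def card_cart_basis)
  then have ge: "vec.dim (l \<inter> m) \<ge> 1"
    using vec.dim_sums_Int[OF sub(1,2)] sub by simp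
  have "vec.dim (l \<inter> m) \<noteq> 2"
  proof
    assume "vec.dim (l \<inter> m) = 2"
    then have "l \<inter> m = l" "l \<inter> m = m"
      using sub by (simp_all add: vec.subspace_dim_equal vec.subspace_inter)
    then show False using lm by simp
  qed
  moreover have "vec.dim (l \<inter> m) \<le> 2"
    using vec.dim_subset[of "l \<inter> m" l] sub by simp
  ultimately show ?thesis
    using ge sub by (simp add: proj_points_def vec.subspace_inter)
qed

lemma card_points_on_two_lines:
  fixes l m :: "('f::{field,finite}^3) set"
  assumes "l \<in> proj_lines" "m \<in> proj_lines" "l \<noteq> m"
  shows "card {s. s \<in> proj_points \<and> s \<subseteq> l \<and> s \<subseteq> m} = 1"
proof -
  have "{s. s \<in> proj_points \<and> s \<subseteq> l \<and> s \<subseteq> m} = {l \<inter> m}"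
  proof (intro equalityI subsetI)
    fix s assume "s \<in> {s. s \<in> proj_points \<and> s \<subseteq> l \<and> s \<subseteq> m}"
    then have "s = l \<inter> m"
      using Int_lines_in_proj_points[OF assms] by (intro vec.subspace_dim_equal) (auto simp: proj_points_def)
    then show "s \<in> {l \<inter> m}" by simp
  qed (use Int_lines_in_proj_points[OF assms] in auto)
  then show ?thesis by simp
qed

lemma perp_in_proj_lines:
  fixes w :: "'f::{field,finite}^3"
  assumes "w \<noteq> 0"
  shows "{v. vdot w v = 0} \<in> proj_lines"
proof -
  have sub: "vec.subspace {v. vdot w v = 0}"
    by (rule vec.subspaceI) (auto simp: vdot_add vdot_smult)
  have "CARD('f) ^ vec.dim {v. vdot w v = 0} = CARD('f) ^ 2"
    using card_subspace[OF sub] card_perp[OF assms] by (simp add: vdot_commute)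
  then have "vec.dim {v. vdot w v = 0} = 2"
    using card_field_gt_1[where 'f='f] power_inject_exp by blast
  with sub show ?thesis by (simp add: proj_lines_def)
qed

lemma span_subset_perp: "vec.span {v} \<subseteq> {u. vdot w u = 0} \<longleftrightarrow> vdot w v = 0"
proof
  assume "vdot w v = 0"
  then show "vec.span {v} \<subseteq> {u. vdot w u = 0}"
    by (intro vec.span_minimal vec.subspaceI) (auto simp: vdot_add vdot_smult)
qed (auto intro: vec.span_base)

text \<open>A line receives the total weight of all its nonzero normal vectors, so that none of them
  has to be chosen as a representative.\<close>

lemma line_combination_of_normals:
  fixes \<beta> :: "'f::{field,finite}^3 \<Rightarrow> 'f"
  obtains b :: "('f^3) set \<Rightarrow> 'f" where
    "\<And>v. v \<noteq> 0 \<Longrightarrow> (\<Sum>l | l \<in> proj_lines \<and> vec.span {v} \<subseteq> l. b l) = (\<Sum>w | w \<noteq> 0 \<and> vdot w v = 0. \<beta> w)"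
proof
  fix v :: "'f^3" assume "v \<noteq> 0"
  define b where "b l = (\<Sum>w | w \<noteq> 0 \<and> {u. vdot w u = 0} = l. \<beta> w)" for l
  have "(\<Sum>w | w \<noteq> 0 \<and> vdot w v = 0. \<beta> w) =
      (\<Sum>l | l \<in> proj_lines \<and> vec.span {v} \<subseteq> l.
        \<Sum>w | w \<in> {w. w \<noteq> 0 \<and> vdot w v = 0} \<and> {u. vdot w u = 0} = l. \<beta> w)"
    by (intro sum.group[symmetric]) (auto simp: perp_in_proj_lines dest: span_subset_perp[THEN iffD2, THEN subsetD, THEN CollectD])
  also have "\<dots> = (\<Sum>l | l \<in> proj_lines \<and> vec.span {v} \<subseteq> l. b l)"
    unfolding b_def
    by (intro sum.cong) (auto simp: span_subset_perp)
  finally show "(\<Sum>l | l \<in> proj_lines \<and> vec.span {v} \<subseteq> l. \<Sum>w | w \<noteq> 0 \<and> {u. vdot w u = 0} = l. \<beta> w) =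
    (\<Sum>w | w \<noteq> 0 \<and> vdot w v = 0. \<beta> w)" unfolding b_def ..
qed

theorem constant_line_sums_imp_line_combination:
  fixes c :: "('f::{field,finite}^3) set \<Rightarrow> 'f"
  assumes q: "Factorial_Ring.prime CARD('f)"
    and c: "\<And>l. l \<in> proj_lines \<Longrightarrow> (\<Sum>s | s \<in> proj_points \<and> s \<subseteq> l. c s) = K"
  obtains b where "\<And>s. s \<in> proj_points \<Longrightarrow> (\<Sum>l | l \<in> proj_lines \<and> s \<subseteq> l. b l) = c s"
proof -
  \<comment> \<open>Subtracting K makes all line sums vanish, because a line has q + 1 points and q
    is 0 in the field.\<close>
  define \<phi> where "\<phi> v = (if v = 0 then 0 else c (vec.span {v}) - K)" for v :: "'f^3"
  have "\<phi> \<in> form_span"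
  proof (intro homogeneous_in_form_span[OF q] moment_eq_0_of_plane_sums[OF q])
    fix a :: 'f and v :: "'f^3" assume "a \<noteq> 0"
    then have "vec.span {a *s v} = vec.span {v}"
      using vec.span_image_scale[of "{v}" "\<lambda>_. a"] by simp
    then show "\<phi> (a *s v) = \<phi> v" using \<open>a \<noteq> 0\<close> by (simp add: \<phi>_def)
  next
    fix w :: "'f^3" assume w: "w \<noteq> 0"
    let ?l = "{v. vdot w v = 0}"
    have l: "?l \<in> proj_lines" using w by (rule perp_in_proj_lines)
    have "(\<Sum>v\<in>?l. \<phi> v) = (\<Sum>v\<in>?l - {0}. c (vec.span {v}) - K)"
      by (intro sum.mono_neutral_cong_right) (auto simp: \<phi>_def)
    also have "\<dots> = of_nat (CARD('f) - 1) * (\<Sum>s | s \<in> proj_points \<and> s \<subseteq> ?l. c s - K)"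
      using l by (intro sum_over_subspace proj_lines_subspace)
    also have "(\<Sum>s | s \<in> proj_points \<and> s \<subseteq> ?l. c s - K) = K - of_nat (CARD('f) + 1) * K"
      by (simp only: sum_subtractf c[OF l] sum_constant card_points_on_line[OF l])
    also have "\<dots> = 0" by (simp add: of_nat_card_field)
    finally show "(\<Sum>v | vdot w v = 0. \<phi> v) = 0" by simp
  qed (simp_all add: \<phi>_def)
  then obtain \<beta> where \<beta>: "\<And>u. \<phi> u = (\<Sum>w\<in>UNIV. \<beta> w * vdot w u ^ (CARD('f) - 1))"
    by (auto simp: form_span_def)
  define T where "T = (\<Sum>w\<in>UNIV - {0}. \<beta> w)"
  \<comment> \<open>The powers are 1 off the planes, so \<open>\<phi> v\<close> is T minus the
    \<open>\<beta>\<close>-weight of the nonzero w orthogonal to v. There are q^2 - 1 such w, which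
    is -1 in the field, so the constant weight -(T + K) contributes T + K, and the part
    -\<open>\<beta>\<close> supplies the rest of \<open>\<phi> v\<close> + K.\<close>
  obtain b where b: "\<And>v. v \<noteq> 0 \<Longrightarrow> (\<Sum>l | l \<in> proj_lines \<and> vec.span {v} \<subseteq> l. b l) =
      (\<Sum>w | w \<noteq> 0 \<and> vdot w v = 0. - (T + K) - \<beta> w)"
    using line_combination_of_normals[of "\<lambda>w. - (T + K) - \<beta> w"] by blast
  have "(\<Sum>l | l \<in> proj_lines \<and> s \<subseteq> l. b l) = c s" if s: "s \<in> proj_points" for s
  proof -
    obtain v where v: "v \<noteq> 0" "s = vec.span {v}"
      using proj_points_nonzero[OF s] .
    have eq: "{w. w \<noteq> 0 \<and> vdot w v = 0} = {w. vdot w v = 0} - {0}" by auto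
    have "of_nat (card {w. w \<noteq> 0 \<and> vdot w v = 0}) = (-1 :: 'f)"
      unfolding eq using v card_field_gt_1[where 'f='f]
      by (subst card_Diff_singleton) (auto simp: card_perp of_nat_diff of_nat_card_field)
    then have "(\<Sum>l | l \<in> proj_lines \<and> s \<subseteq> l. b l) = T + K - (\<Sum>w | w \<noteq> 0 \<and> vdot w v = 0. \<beta> w)"
      using b[OF v(1)] by (simp add: v sum_subtractf)
    also have "T - (\<Sum>w | w \<noteq> 0 \<and> vdot w v = 0. \<beta> w) = (\<Sum>w | w \<noteq> 0 \<and> vdot w v \<noteq> 0. \<beta> w)"
    proof -
      have "T = (\<Sum>w | w \<noteq> 0 \<and> vdot w v = 0. \<beta> w) + (\<Sum>w | w \<noteq> 0 \<and> vdot w v \<noteq> 0. \<beta> w)"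
        unfolding T_def by (subst sum.union_disjoint[symmetric]) (auto intro!: sum.cong)
      then show ?thesis by simp
    qed
    then have "T + K - (\<Sum>w | w \<noteq> 0 \<and> vdot w v = 0. \<beta> w) = (\<Sum>w | w \<noteq> 0 \<and> vdot w v \<noteq> 0. \<beta> w) + K"
      by (simp add: algebra_simps)
    also have "(\<Sum>w | w \<noteq> 0 \<and> vdot w v \<noteq> 0. \<beta> w) = \<phi> v"
      unfolding \<beta> power_card_minus_1_eq by (intro sum.mono_neutral_cong_left) auto
    also have "\<phi> v + K = c s" using v by (simp add: \<phi>_def)
    finally show ?thesis .
  qed
  then show ?thesis using that by blast
qed

section \<open>Orders in the quaternions\<close>

lemma qcnj_simps [simp]:
  "qcnj 0 = 0" "qcnj 1 = 1" "qcnj (x + y) = qcnj x + qcnj y" "qcnj (x - y) = qcnj x - qcnj y"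
  "qcnj (- x) = - qcnj x" "qcnj (qcnj x) = x" "qcnj (x * y) = qcnj y * qcnj x"
  by (simp_all add: quat_eq_iff algebra_simps)

lemma qcnj_sum: "qcnj (sum f A) = (\<Sum>x\<in>A. qcnj (f x))"
  by (induction A rule: infinite_finite_induct) simp_all

lemma quat_of_nat_simps [simp]:
  "qRe (of_nat n) = of_nat n" "qI (of_nat n) = 0" "qJ (of_nat n) = 0" "qK (of_nat n) = 0"
  by (induction n) simp_all

lemma qcnj_of_nat [simp]: "qcnj (of_nat n) = of_nat n"
  by (simp add: quat_eq_iff)

lemma mult_qcnj_eq_of_nat: "(qnorm z)\<^sup>2 = real n \<Longrightarrow> z * qcnj z = of_nat n"
  by (simp add: quat_eq_iff qnorm_def power2_eq_square)

text \<open>What an admissible triple provides for the computations. Products keep their order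
  throughout, and divisibility by p on both sides is derived from the congruence between z and its
  conjugate.\<close>

locale conj_congruent_order =
  fixes \<O> :: "quat set" and p :: quat and q :: nat
  assumes one_closed [simp]: "1 \<in> \<O>"
    and diff_closed [simp]: "x \<in> \<O> \<Longrightarrow> y \<in> \<O> \<Longrightarrow> x - y \<in> \<O>"
    and mult_closed [simp]: "x \<in> \<O> \<Longrightarrow> y \<in> \<O> \<Longrightarrow> x * y \<in> \<O>"
    and cnj_closed [simp]: "x \<in> \<O> \<Longrightarrow> qcnj x \<in> \<O>"
    and p_closed [simp]: "p \<in> \<O>"
    and q_pos: "q > 0"
    and p_norm: "p * qcnj p = of_nat q"
    and cnj_congruent: "z \<in> \<O> \<Longrightarrow> qcnj z - z \<in> right_multiples \<O> p"
begin

lemma zero_closed [simp]: "0 \<in> \<O>"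
  using diff_closed[OF one_closed one_closed] by simp

lemma uminus_closed [simp]: "x \<in> \<O> \<Longrightarrow> - x \<in> \<O>"
  using diff_closed[OF zero_closed] by simp

lemma add_closed [simp]: "x \<in> \<O> \<Longrightarrow> y \<in> \<O> \<Longrightarrow> x + y \<in> \<O>"
  using diff_closed[OF _ uminus_closed[of y], of x] by simp

lemma of_nat_closed [simp]: "of_nat n \<in> \<O>"
  by (induction n) simp_all

lemma sum_closed: "(\<And>x. x \<in> A \<Longrightarrow> f x \<in> \<O>) \<Longrightarrow> sum f A \<in> \<O>"
  by (induction A rule: infinite_finite_induct) simp_all

lemma of_nat_q_neq_0 [simp]: "of_nat q \<noteq> (0::quat)"
  using q_pos by (simp add: quat_eq_iff)

lemma p_neq_0 [simp]: "p \<noteq> 0" and cnj_p_neq_0 [simp]: "qcnj p \<noteq> 0"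
  using p_norm of_nat_q_neq_0 by force+

lemma cnj_p_p: "qcnj p * p = of_nat q"
proof -
  have "p * (qcnj p * p) = p * of_nat q"
    using p_norm by (metis mult.assoc mult_of_nat_commute)
  then show ?thesis by simp
qed

lemma p_cnj_p_left: "p * (qcnj p * x) = of_nat q * x"
  and cnj_p_p_left: "qcnj p * (p * x) = of_nat q * x"
  by (simp_all add: p_norm cnj_p_p flip: mult.assoc)

section \<open>Divisibility by p and by its conjugate\<close>

abbreviation "p\<O> \<equiv> right_multiples \<O> p"

lemma right_multiples_add: "x \<in> p\<O> \<Longrightarrow> y \<in> p\<O> \<Longrightarrow> x + y \<in> p\<O>"
  unfolding right_multiples_def
  by clarify (metis (mono_tags, lifting) add_closed distrib_left mem_Collect_eq)

lemma right_multiples_mult: "x \<in> p\<O> \<Longrightarrow> y \<in> \<O> \<Longrightarrow> x * y \<in> p\<O>"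
  unfolding right_multiples_def
  by clarify (metis (mono_tags, lifting) mult_closed mult.assoc)

lemma right_multiples_sum: "(\<And>x. x \<in> A \<Longrightarrow> f x \<in> p\<O>) \<Longrightarrow> sum f A \<in> p\<O>"
proof (induction A rule: infinite_finite_induct)
  case (insert x A)
  then show ?case by (simp add: right_multiples_add)
qed (auto simp: right_multiples_def intro!: exI[of _ 0])

lemma p_in_right_multiples: "p \<in> p\<O>"
  by (auto simp: right_multiples_def intro!: exI[of _ 1])

lemma right_multiples_subset: "x \<in> p\<O> \<Longrightarrow> x \<in> \<O>"
  by (auto simp: right_multiples_def)

lemma cnj_p_in_right_multiples: "qcnj p \<in> p\<O>"
  using right_multiples_add[OF cnj_congruent[OF p_closed] p_in_right_multiples] by simp

text \<open>Conjugation reverses products: z p is the conjugate of \<open>qcnj p * qcnj z\<close>,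
  which is a right multiple of p, and passing to the conjugate does not change the class modulo
  p.\<close>

lemma mult_p_in_right_multiples:
  assumes "z \<in> \<O>"
  shows "z * p \<in> p\<O>"
proof -
  let ?y = "qcnj p * qcnj z"
  have "qcnj ?y - ?y \<in> p\<O>" using assms by (intro cnj_congruent) simp
  moreover have "?y \<in> p\<O>" using assms by (intro right_multiples_mult cnj_p_in_right_multiples) simp
  ultimately have "(qcnj ?y - ?y) + ?y \<in> p\<O>" by (rule right_multiples_add)
  then show ?thesis by simp
qed

lemma mult_in_right_multiples: "z \<in> \<O> \<Longrightarrow> x \<in> p\<O> \<Longrightarrow> z * x \<in> p\<O>"
  using right_multiples_mult[OF mult_p_in_right_multiples]
  by (auto simp: right_multiples_def mult.assoc[symmetric])

text \<open>Write \<open>qcnj p = p * u\<close>. Both \<open>qcnj p * p\<close> and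
  \<open>p * qcnj p\<close> are q, and comparing them shows that u times its conjugate is 1; so p
  and \<open>qcnj p\<close> differ by a unit on the right.\<close>

lemma right_multiples_cnj_p: "right_multiples \<O> (qcnj p) = p\<O>"
proof -
  obtain u where u: "u \<in> \<O>" "qcnj p = p * u"
    using cnj_p_in_right_multiples by (auto simp: right_multiples_def)
  have cu: "p = qcnj u * qcnj p"
    using arg_cong[OF u(2), of qcnj] by simp
  have "p * (u * qcnj u - 1) * qcnj p = (p * u) * (qcnj u * qcnj p) - p * qcnj p"
    by (simp add: algebra_simps)
  also have "\<dots> = 0" by (simp add: cnj_p_p p_norm flip: u(2) cu)
  finally have "u * qcnj u = 1" by simp
  then have "p = qcnj p * qcnj u" by (simp add: u(2) mult.assoc)
  then have "p \<in> right_multiples \<O> (qcnj p)"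
    using u(1) by (auto simp: right_multiples_def)
  then have "p * a \<in> right_multiples \<O> (qcnj p)" if "a \<in> \<O>" for a
    using that by (auto simp: right_multiples_def) (metis mult.assoc mult_closed)
  moreover have "qcnj p * a \<in> p\<O>" if "a \<in> \<O>" for a
    using that by (intro right_multiples_mult cnj_p_in_right_multiples)
  ultimately show ?thesis by (force simp: right_multiples_def)
qed

lemma right_multiplesE:
  assumes "x \<in> p\<O>"
  obtains a where "a \<in> \<O>" "x = p * a"
  using assms by (auto simp: right_multiples_def)

lemma right_multiples_cnjE:
  assumes "x \<in> p\<O>"
  obtains a where "a \<in> \<O>" "x = qcnj p * a"
  using assms unfolding right_multiples_cnj_p[symmetric] by (auto simp: right_multiples_def)

text \<open>
  A solution \<open>w\<close> modulo \<open>p\<close> of the equations of the points leaves the same error \<open>e\<close> in the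
  equations of all lines; adding a multiple of a vector supported on one line \<open>l0\<close> and its points
  cancels it.
\<close>

lemma solve_incidence_system:
  fixes P L :: "'b set" and inc :: "'b \<Rightarrow> 'b \<Rightarrow> bool" and c d w :: "'b \<Rightarrow> quat"
  assumes fin: "finite P" "finite L" and ne: "L \<noteq> {}"
    and inc: "\<And>l m. l \<in> L \<Longrightarrow> m \<in> L \<Longrightarrow>
      card {s. s \<in> P \<and> inc s l \<and> inc s m} = (if l = m then q + 1 else 1)"
    and d: "\<And>l. l \<in> L \<Longrightarrow> d l \<in> \<O>"
    and cd: "\<And>l. l \<in> L \<Longrightarrow> (\<Sum>s | s \<in> P \<and> inc s l. c s) + qcnj p * d l = K"
    and w: "\<And>l. l \<in> L \<Longrightarrow> w l \<in> \<O>"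
    and wc: "\<And>s. s \<in> P \<Longrightarrow> (\<Sum>l | l \<in> L \<and> inc s l. w l) - c s \<in> p\<O>"
  shows "\<exists>a b. (\<forall>s\<in>P. a s \<in> \<O> \<and> (\<Sum>l | l \<in> L \<and> inc s l. b l) - qcnj p * a s = c s) \<and>
    (\<forall>l\<in>L. b l \<in> \<O> \<and> (\<Sum>s | s \<in> P \<and> inc s l. a s) - p * b l = d l)"
proof -
  have "\<exists>a. a \<in> \<O> \<and> (\<Sum>l | l \<in> L \<and> inc s l. w l) - c s = qcnj p * a" if "s \<in> P" for s
    using right_multiples_cnjE[OF wc[OF that]] by metis
  then obtain a0 where a0: "\<And>s. s \<in> P \<Longrightarrow> a0 s \<in> \<O>"
    and a0c: "\<And>s. s \<in> P \<Longrightarrow> (\<Sum>l | l \<in> L \<and> inc s l. w l) - c s = qcnj p * a0 s"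
    by metis
  define err where "err l = (\<Sum>s | s \<in> P \<and> inc s l. a0 s) - p * w l - d l" for l
  \<comment> \<open>After multiplication by \<open>qcnj p\<close> the equations of the points
    express the sum of \<open>a0\<close> over l through \<open>w\<close>. Each line m is counted
    once per common point with l, which yields q times \<open>w l\<close> plus the sum of all
    \<open>w\<close>; the first term cancels against \<open>qcnj p * p * w l\<close>, and nothing
    left depends on l.\<close>
  have err: "qcnj p * err l = (\<Sum>m\<in>L. w m) - K" if l: "l \<in> L" for l
  proof -
    have "(\<Sum>s | s \<in> P \<and> inc s l. \<Sum>m | m \<in> L \<and> inc s m. w m) =
        (\<Sum>m\<in>L. \<Sum>s | s \<in> {s. s \<in> P \<and> inc s l} \<and> inc s m. w m)"
      using fin by (intro sum.swap_restrict) auto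
    also have "\<dots> = (\<Sum>m\<in>L. of_nat (if m = l then q + 1 else 1) * w m)"
      using inc[OF l] by (intro sum.cong) auto
    also have "\<dots> = (\<Sum>m\<in>L. (if m = l then of_nat q * w l else 0) + w m)"
      by (intro sum.cong) (auto simp: algebra_simps)
    also have "\<dots> = of_nat q * w l + (\<Sum>m\<in>L. w m)"
      using fin l by (simp add: sum.distrib)
    finally have *: "(\<Sum>s | s \<in> P \<and> inc s l. \<Sum>m | m \<in> L \<and> inc s m. w m) =
      of_nat q * w l + (\<Sum>m\<in>L. w m)" .
    have "qcnj p * err l = (\<Sum>s | s \<in> P \<and> inc s l. qcnj p * a0 s) - of_nat q * w l - qcnj p * d l"
      by (simp add: err_def right_diff_distrib sum_distrib_left cnj_p_p_left)
    also have "(\<Sum>s | s \<in> P \<and> inc s l. qcnj p * a0 s) =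
      (\<Sum>s | s \<in> P \<and> inc s l. \<Sum>m | m \<in> L \<and> inc s m. w m) - (\<Sum>s | s \<in> P \<and> inc s l. c s)"
      unfolding sum_subtractf[symmetric] by (intro sum.cong) (auto simp: a0c)
    finally show ?thesis using * by (simp add: algebra_simps flip: cd[OF l])
  qed
  obtain l0 where l0: "l0 \<in> L" using ne by blast
  define e where "e = err l0"
  have e: "e \<in> \<O>"
    using a0 w d l0 unfolding e_def err_def by (intro diff_closed sum_closed mult_closed p_closed) auto
  have err_eq: "err l = e" if "l \<in> L" for l
  proof -
    have "qcnj p * err l = qcnj p * e" using err[OF that] err[OF l0] by (simp add: e_def)
    then show ?thesis by simp
  qed
  \<comment> \<open>The correction is e on the points of \<open>l0\<close> and
    \<open>qcnj p * e\<close> at \<open>l0\<close>. It respects the equations of the points and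
    amounts to e in the equation of every line: at \<open>l0\<close> the points give (q + 1) e, of
    which p times \<open>qcnj p * e\<close> removes q e.\<close>
  define a where "a s = a0 s - (if inc s l0 then e else 0)" for s
  define b where "b l = w l - (if l = l0 then qcnj p * e else 0)" for l
  show ?thesis
  proof (rule exI[of _ a], rule exI[of _ b], intro conjI ballI)
    show "a s \<in> \<O>" if "s \<in> P" for s using that a0 e by (simp add: a_def)
    show "b l \<in> \<O>" if "l \<in> L" for l using that w e by (simp add: b_def)
    show "(\<Sum>l | l \<in> L \<and> inc s l. b l) - qcnj p * a s = c s" if s: "s \<in> P" for s
    proof -
      have "(\<Sum>l | l \<in> L \<and> inc s l. b l) =
          (\<Sum>l | l \<in> L \<and> inc s l. w l) - (if inc s l0 then qcnj p * e else 0)"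
        using fin l0 by (simp add: b_def sum_subtractf sum.delta)
      moreover have "qcnj p * a s = qcnj p * a0 s - (if inc s l0 then qcnj p * e else 0)"
        by (simp add: a_def right_diff_distrib)
      ultimately show ?thesis by (simp add: a0c[OF s, symmetric])
    qed
    show "(\<Sum>s | s \<in> P \<and> inc s l. a s) - p * b l = d l" if l: "l \<in> L" for l
    proof -
      have "(\<Sum>s | s \<in> P \<and> inc s l. if inc s l0 then e else 0) =
          (\<Sum>s | s \<in> P \<and> inc s l \<and> inc s l0. e)"
        using fin by (intro sum.mono_neutral_cong_right) auto
      also have "\<dots> = of_nat (if l = l0 then q + 1 else 1) * e"
        using inc[OF l l0] by simp
      finally have "(\<Sum>s | s \<in> P \<and> inc s l. a s) =
          (\<Sum>s | s \<in> P \<and> inc s l. a0 s) - of_nat (if l = l0 then q + 1 else 1) * e"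
        by (simp add: a_def sum_subtractf)
      moreover have "(\<Sum>s | s \<in> P \<and> inc s l. a0 s) = e + p * w l + d l"
        using err_eq[OF l] by (simp add: err_def algebra_simps)
      ultimately show ?thesis
        by (cases "l = l0") (simp_all add: b_def right_diff_distrib p_cnj_p_left algebra_simps)
    qed
  qed
qed

end

section \<open>Duals of quotients of free Hermitian modules\<close>

locale free_hermitian = conj_congruent_order +
  fixes B :: "'b set" and g :: "'b \<Rightarrow> 'b \<Rightarrow> quat" and M :: "('b \<Rightarrow> quat) herm_module"
  assumes M_def: "M = free_herm_module \<O> B g"
    and finite_B: "finite B"
    and g_closed: "r \<in> B \<Longrightarrow> s \<in> B \<Longrightarrow> g r s \<in> \<O>"
    and g_hermitian: "r \<in> B \<Longrightarrow> s \<in> B \<Longrightarrow> qcnj (g r s) = g s r"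
begin

lemma vecs_iff: "x \<in> vecs M \<longleftrightarrow> (\<forall>r\<in>B. x r \<in> \<O>) \<and> (\<forall>r. r \<notin> B \<longrightarrow> x r = 0)"
  and vadd_eq: "vadd M x y = (\<lambda>r. x r + y r)"
  and vscale_eq: "vscale M x a = (\<lambda>r. x r * a)"
  and form_eq: "form M x y = (\<Sum>r\<in>B. \<Sum>s\<in>B. qcnj (x r) * g r s * y s)"
  by (simp_all add: M_def free_herm_module_def)

lemma form_eq_rows: "form M x y = (\<Sum>r\<in>B. qcnj (x r) * (\<Sum>s\<in>B. g r s * y s))"
  by (simp add: form_eq sum_distrib_left mult.assoc)

lemma form_eq_columns: "form M x y = (\<Sum>s\<in>B. (\<Sum>r\<in>B. qcnj (x r) * g r s) * y s)"
  unfolding form_eq sum_distrib_right by (rule sum.swap)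

lemma form_add_left: "form M (vadd M x y) z = form M x z + form M y z"
  by (simp add: form_eq_rows vadd_eq distrib_right sum.distrib)

lemma form_add_right: "form M x (vadd M y z) = form M x y + form M x z"
  by (simp add: form_eq_columns vadd_eq distrib_left sum.distrib)

lemma form_scale_right: "form M x (vscale M y a) = form M x y * a"
  by (simp add: form_eq_columns vscale_eq sum_distrib_right mult.assoc)

lemma form_cnj: "qcnj (form M x y) = form M y x"
proof -
  have "qcnj (form M x y) = (\<Sum>r\<in>B. \<Sum>s\<in>B. qcnj (y s) * g s r * x r)"
    unfolding form_eq qcnj_sum by (intro sum.cong) (simp_all add: g_hermitian mult.assoc)
  also have "\<dots> = form M y x" unfolding form_eq by (rule sum.swap)
  finally show ?thesis .
qed

lemma vadd_closed: "x \<in> vecs M \<Longrightarrow> y \<in> vecs M \<Longrightarrow> vadd M x y \<in> vecs M"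
  and vscale_closed: "x \<in> vecs M \<Longrightarrow> a \<in> \<O> \<Longrightarrow> vscale M x a \<in> vecs M"
  and zero_vec: "(\<lambda>_. 0) \<in> vecs M"
  by (simp_all add: vecs_iff vadd_eq vscale_eq)

lemma radical_subset: "x \<in> radical M \<Longrightarrow> x \<in> vecs M"
  by (simp add: radical_def)

lemma form_radical_right: "x \<in> radical M \<Longrightarrow> y \<in> vecs M \<Longrightarrow> form M y x = 0"
  by (simp add: radical_def)

lemma form_radical_left: "x \<in> radical M \<Longrightarrow> y \<in> vecs M \<Longrightarrow> form M x y = 0"
  using form_radical_right[of x y] form_cnj[of y x] by simp

lemma zero_radical: "(\<lambda>_. 0) \<in> radical M"
  by (simp add: radical_def zero_vec form_eq)

lemma radical_add: "x \<in> radical M \<Longrightarrow> y \<in> radical M \<Longrightarrow> vadd M x y \<in> radical M"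
  by (simp add: radical_def vadd_closed form_add_right)

lemma radical_scale: "x \<in> radical M \<Longrightarrow> a \<in> \<O> \<Longrightarrow> vscale M x a \<in> radical M"
  by (simp add: radical_def vscale_closed form_scale_right)

lemma radicalI:
  assumes "x \<in> vecs M" "\<And>r. r \<in> B \<Longrightarrow> (\<Sum>s\<in>B. g r s * x s) = 0"
  shows "x \<in> radical M"
  using assms by (simp add: radical_def form_eq_rows)

lemma mem_rad_coset: "y \<in> rad_coset M x \<longleftrightarrow> (\<exists>z\<in>radical M. y = vadd M x z)"
  by (auto simp: rad_coset_def)

lemma rad_coset_self: "x \<in> rad_coset M x"
  unfolding mem_rad_coset by (rule bexI[OF _ zero_radical]) (simp add: vadd_eq)

lemma rad_coset_eq:
  assumes "y \<in> rad_coset M x"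
  shows "rad_coset M y = rad_coset M x"
proof -
  obtain z where z: "z \<in> radical M" "y = vadd M x z" using assms by (auto simp: mem_rad_coset)
  have neg: "vscale M z (-1) \<in> radical M" using z by (intro radical_scale) simp_all
  show ?thesis
  proof (intro equalityI subsetI)
    fix u assume "u \<in> rad_coset M y"
    then obtain w where w: "w \<in> radical M" "u = vadd M y w" by (auto simp: mem_rad_coset)
    then have "u = vadd M x (vadd M z w)" by (simp add: z vadd_eq add.assoc)
    then show "u \<in> rad_coset M x" using radical_add[OF z(1) w(1)] by (auto simp: mem_rad_coset)
  next
    fix u assume "u \<in> rad_coset M x"
    then obtain w where w: "w \<in> radical M" "u = vadd M x w" by (auto simp: mem_rad_coset)
    then have "u = vadd M y (vadd M (vscale M z (-1)) w)"
      by (simp add: z vadd_eq vscale_eq add.assoc)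
    then show "u \<in> rad_coset M y" using radical_add[OF neg w(1)] by (auto simp: mem_rad_coset)
  qed
qed

section \<open>The quotient by the radical and its dual\<close>

abbreviation "Q \<equiv> mod_radical M"

lemma vecs_Q: "vecs Q = rad_coset M ` vecs M"
  by (simp add: mod_radical_def)

lemma vadd_Q: "vadd Q (rad_coset M x) (rad_coset M y) = rad_coset M (vadd M x y)"
proof -
  have eq: "rad_coset M (vadd M x' y') = rad_coset M (vadd M x y)"
    if xy: "x' \<in> rad_coset M x" "y' \<in> rad_coset M y" for x' y'
  proof (rule rad_coset_eq)
    obtain u v where "u \<in> radical M" "x' = vadd M x u" "v \<in> radical M" "y' = vadd M y v"
      using xy by (auto simp: mem_rad_coset)
    then show "vadd M x' y' \<in> rad_coset M (vadd M x y)"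
      by (auto simp: mem_rad_coset vadd_eq add_ac intro!: bexI[OF _ radical_add[of u v]])
  qed
  have "(\<Union>x'\<in>rad_coset M x. \<Union>y'\<in>rad_coset M y. rad_coset M (vadd M x' y')) =
      (\<Union>x'\<in>rad_coset M x. \<Union>y'\<in>rad_coset M y. rad_coset M (vadd M x y))"
    by (intro SUP_cong refl eq)
  also have "\<dots> = rad_coset M (vadd M x y)"
    using rad_coset_self[of x] rad_coset_self[of y] by blast
  finally show ?thesis by (simp add: mod_radical_def)
qed

lemma vscale_Q:
  assumes "a \<in> \<O>"
  shows "vscale Q (rad_coset M x) a = rad_coset M (vscale M x a)"
proof -
  have eq: "rad_coset M (vscale M x' a) = rad_coset M (vscale M x a)" if x: "x' \<in> rad_coset M x" for x'
  proof (rule rad_coset_eq)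
    obtain u where "u \<in> radical M" "x' = vadd M x u"
      using x by (auto simp: mem_rad_coset)
    then show "vscale M x' a \<in> rad_coset M (vscale M x a)"
      by (auto simp: mem_rad_coset vadd_eq vscale_eq distrib_right
          intro!: bexI[OF _ radical_scale[OF _ assms, of u]])
  qed
  have "(\<Union>x'\<in>rad_coset M x. rad_coset M (vscale M x' a)) =
      (\<Union>x'\<in>rad_coset M x. rad_coset M (vscale M x a))"
    by (intro SUP_cong refl eq)
  also have "\<dots> = rad_coset M (vscale M x a)"
    using rad_coset_self[of x] by blast
  finally show ?thesis by (simp add: mod_radical_def)
qed

lemma form_Q:
  assumes "x \<in> vecs M" "y \<in> vecs M"
  shows "form Q (rad_coset M x) (rad_coset M y) = form M x y"
proof -
  have "form M x' y' = form M x y" if xy: "x' \<in> rad_coset M x" "y' \<in> rad_coset M y" for x' y'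
  proof -
    obtain u v where "u \<in> radical M" "x' = vadd M x u" "v \<in> radical M" "y' = vadd M y v"
      using xy by (auto simp: mem_rad_coset)
    then show ?thesis using assms
      by (simp add: form_add_left form_add_right form_radical_left form_radical_right radical_subset)
  qed
  then have "{form M x' y' |x' y'. x' \<in> rad_coset M x \<and> y' \<in> rad_coset M y} = {form M x y}"
    using rad_coset_self[of x] rad_coset_self[of y] by blast
  then show ?thesis by (simp add: mod_radical_def)
qed

definition unit_vec :: "'b \<Rightarrow> 'b \<Rightarrow> quat" where
  "unit_vec r = (\<lambda>t. if t = r then 1 else 0)"

lemma unit_vec_closed: "r \<in> B \<Longrightarrow> unit_vec r \<in> vecs M"
  by (auto simp: vecs_iff unit_vec_def)

lemma dual_expand:
  assumes f: "f \<in> dual \<O> Q" and x: "x \<in> vecs M"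
  shows "f (rad_coset M x) = (\<Sum>r\<in>B. f (rad_coset M (unit_vec r)) * x r)"
proof -
  have add: "f (rad_coset M (vadd M y z)) = f (rad_coset M y) + f (rad_coset M z)"
    if "y \<in> vecs M" "z \<in> vecs M" for y z
    using f that by (auto simp: dual_def vecs_Q vadd_Q[symmetric])
  have scale: "f (rad_coset M (vscale M y a)) = f (rad_coset M y) * a"
    if "y \<in> vecs M" "a \<in> \<O>" for y a
    using f that by (auto simp: dual_def vecs_Q vscale_Q[symmetric])
  have "f (rad_coset M (\<lambda>t. if t \<in> A then x t else 0)) = (\<Sum>r\<in>A. f (rad_coset M (unit_vec r)) * x r)"
    if "A \<subseteq> B" for A
    using finite_subset[OF that finite_B] that
  proof (induction A)
    case empty
    then show ?case using scale[OF zero_vec zero_closed] by (simp add: vscale_eq)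
  next
    case (insert r A)
    have "(\<lambda>t. if t \<in> insert r A then x t else 0) =
      vadd M (vscale M (unit_vec r) (x r)) (\<lambda>t. if t \<in> A then x t else 0)"
      using insert.hyps by (auto simp: vadd_eq vscale_eq unit_vec_def)
    moreover have "(\<lambda>t. if t \<in> A then x t else 0) \<in> vecs M"
      using insert.prems x by (auto simp: vecs_iff)
    moreover have "x r \<in> \<O>" using insert.prems x by (auto simp: vecs_iff)
    ultimately show ?case
      using insert by (simp add: add scale unit_vec_closed vscale_closed)
  qed
  moreover have "(\<lambda>t. if t \<in> B then x t else 0) = x"
    using x by (auto simp: vecs_iff)
  ultimately show ?thesis by (metis order_refl)
qed

text \<open>Divisible Gram entries put L into p L'. For the other inclusion,
  \<open>dual_scale\<close> by p multiplies values by \<open>qcnj p\<close>, so x has to pair with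
  the basis vectors to \<open>qcnj p * \<phi> s\<close>; the system in \<open>represent\<close> is
  the conjugate of this requirement.\<close>

lemma p_modular_mod_radicalI:
  assumes divisible: "\<And>r s. r \<in> B \<Longrightarrow> s \<in> B \<Longrightarrow> g r s \<in> p\<O>"
    and represent: "\<And>\<phi>. \<lbrakk>\<And>r. r \<in> B \<Longrightarrow> \<phi> r \<in> \<O>;
      \<And>z. z \<in> radical M \<Longrightarrow> (\<Sum>r\<in>B. \<phi> r * z r) = 0\<rbrakk> \<Longrightarrow>
      \<exists>x\<in>vecs M. \<forall>s\<in>B. (\<Sum>r\<in>B. g s r * x r) = qcnj (\<phi> s) * p"
  shows "p_modular \<O> p Q"
  unfolding p_modular_def
proof (intro equalityI subsetI)
  fix F assume "F \<in> (\<lambda>f. dual_scale Q f p) ` dual \<O> Q"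
  then obtain f where f: "f \<in> dual \<O> Q" and F: "F = dual_scale Q f p" by blast
  define \<phi> where "\<phi> r = f (rad_coset M (unit_vec r))" for r
  have f_eq: "f (rad_coset M x) = (\<Sum>r\<in>B. \<phi> r * x r)" if "x \<in> vecs M" for x
    using dual_expand[OF f that] by (simp add: \<phi>_def)
  have "\<phi> r \<in> \<O>" if "r \<in> B" for r
    using f unit_vec_closed[OF that] by (auto simp: \<phi>_def dual_def vecs_Q)
  moreover have "(\<Sum>r\<in>B. \<phi> r * z r) = 0" if z: "z \<in> radical M" for z
  proof -
    have "rad_coset M z = rad_coset M (\<lambda>_. 0)"
      using z by (intro rad_coset_eq) (auto simp: mem_rad_coset vadd_eq)
    then show ?thesis
      using f_eq[OF radical_subset[OF z]] f_eq[OF zero_vec] by simp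
  qed
  ultimately obtain x where x: "x \<in> vecs M" and
    xs: "\<And>s. s \<in> B \<Longrightarrow> (\<Sum>r\<in>B. g s r * x r) = qcnj (\<phi> s) * p"
    using represent by meson
  have col: "(\<Sum>r\<in>B. qcnj (x r) * g r s) = qcnj p * \<phi> s" if "s \<in> B" for s
  proof -
    have "(\<Sum>r\<in>B. qcnj (x r) * g r s) = qcnj (\<Sum>r\<in>B. g s r * x r)"
      unfolding qcnj_sum using that by (intro sum.cong) (simp_all add: g_hermitian)
    then show ?thesis by (simp add: xs[OF that])
  qed
  have "F = to_dual Q (rad_coset M x)"
  proof
    fix Y
    show "F Y = to_dual Q (rad_coset M x) Y"
    proof (cases "Y \<in> vecs Q")
      case True
      then obtain y where y: "y \<in> vecs M" "Y = rad_coset M y" by (auto simp: vecs_Q)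
      have "form M x y = (\<Sum>s\<in>B. qcnj p * \<phi> s * y s)"
        unfolding form_eq_columns by (intro sum.cong) (simp_all add: col)
      then show ?thesis
        using True y x by (simp add: F dual_scale_def to_dual_def form_Q f_eq sum_distrib_left mult.assoc)
    qed (simp add: F dual_scale_def to_dual_def)
  qed
  then show "F \<in> to_dual Q ` vecs Q" using x by (auto simp: vecs_Q)
next
  fix F assume "F \<in> to_dual Q ` vecs Q"
  then obtain x where x: "x \<in> vecs M" and F: "F = to_dual Q (rad_coset M x)"
    by (auto simp: vecs_Q)
  \<comment> \<open>Scaling by p in the dual is left multiplication by \<open>qcnj p\<close>, which
    the inverse factor undoes.\<close>
  define f where "f = (\<lambda>Y\<in>vecs Q. inverse (qcnj p) * form Q (rad_coset M x) Y)"
  have f_eq: "f (rad_coset M y) = inverse (qcnj p) * form M x y" if "y \<in> vecs M" for y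
    using that x by (simp add: f_def vecs_Q form_Q)
  have "inverse (qcnj p) * form M x y \<in> \<O>" if y: "y \<in> vecs M" for y
  proof -
    have "form M x y \<in> p\<O>"
      unfolding form_eq using x y divisible
      by (intro right_multiples_sum right_multiples_mult mult_in_right_multiples)
        (auto simp: vecs_iff)
    \<comment> \<open>The factor to be split off is \<open>qcnj p\<close> rather than p; both
      generate the same ideal.\<close>
    then obtain a where "a \<in> \<O>" "form M x y = qcnj p * a" by (rule right_multiples_cnjE)
    then show ?thesis by (simp add: mult.assoc[symmetric])
  qed
  then have "f \<in> dual \<O> Q"
    unfolding dual_def
    by (auto simp: vecs_Q vadd_Q vscale_Q f_eq vadd_closed vscale_closed form_add_right
        form_scale_right distrib_left mult.assoc) (auto simp: f_def vecs_Q)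
  moreover have "dual_scale Q f p = F"
    by (auto simp: dual_scale_def F to_dual_def f_def mult.assoc[symmetric] intro!: restrict_ext)
  ultimately show "F \<in> (\<lambda>f. dual_scale Q f p) ` dual \<O> Q" by blast
qed

end

section \<open>The lattice of the projective plane\<close>

lemma proj_points_lines_disjoint: "proj_points \<inter> proj_lines = {}"
  by (auto simp: proj_points_def proj_lines_def)

lemma proj_lines_nonempty: "(proj_lines :: ('f::{field,finite}^3) set set) \<noteq> {}"
  using perp_in_proj_lines[of "axis 1 (1::'f)"] by (auto simp: axis_eq_0_iff)

text \<open>Reduction modulo p is recorded as an additive map: the incidence equations have
  coefficients 0 and 1, apart from terms divisible by p, which the map kills.\<close>

locale residue_order = conj_congruent_order +
  fixes \<pi> :: "quat \<Rightarrow> 'f::{field,finite}"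
  assumes residue_add: "x \<in> \<O> \<Longrightarrow> y \<in> \<O> \<Longrightarrow> \<pi> (x + y) = \<pi> x + \<pi> y"
    and residue_kernel: "x \<in> \<O> \<Longrightarrow> \<pi> x = 0 \<longleftrightarrow> x \<in> p\<O>"
    and residue_surj: "\<exists>x\<in>\<O>. \<pi> x = \<alpha>"
    and card_residue: "CARD('f) = q"
    and prime_q: "Factorial_Ring.prime q"
begin

lemma residue_0: "\<pi> 0 = 0"
proof -
  have "\<pi> 0 + \<pi> 0 = \<pi> (0 + 0)" by (rule residue_add[symmetric]) simp_all
  then have "\<pi> 0 + \<pi> 0 = \<pi> 0 + 0" by (simp only: add_0_right)
  then show ?thesis by (rule add_left_imp_eq)
qed

lemma residue_diff: "x \<in> \<O> \<Longrightarrow> y \<in> \<O> \<Longrightarrow> \<pi> (x - y) = \<pi> x - \<pi> y"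
  using residue_add[of "x - y" y] by simp

lemma residue_sum: "(\<And>x. x \<in> A \<Longrightarrow> f x \<in> \<O>) \<Longrightarrow> \<pi> (sum f A) = (\<Sum>x\<in>A. \<pi> (f x))"
  by (induction A rule: infinite_finite_induct) (simp_all add: residue_0 residue_add sum_closed)

abbreviation points :: "('f^3) set set" where "points \<equiv> proj_points"
abbreviation lines :: "('f^3) set set" where "lines \<equiv> proj_lines"

sublocale plane: free_hermitian \<O> p q "points \<union> lines" "plane_gram p q" "plane_lattice0 \<O> p q"
proof unfold_locales
  fix r s assume "r \<in> points \<union> lines" "s \<in> points \<union> lines"
  show "plane_gram p q r s \<in> \<O>" by (simp add: plane_gram_def)
  show "qcnj (plane_gram p q r s) = plane_gram p q s r"
    using proj_points_lines_disjoint[where 'a='f] by (auto simp: plane_gram_def)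
qed (simp_all add: plane_lattice0_def)

section \<open>Rows of the Gram matrix and line vectors\<close>

lemma point_row:
  assumes "r \<in> points"
  shows "(\<Sum>s\<in>points \<union> lines. plane_gram p q r s * x s) =
    p * (\<Sum>l | l \<in> lines \<and> r \<subseteq> l. x l) - of_nat q * x r"
proof -
  have r: "r \<notin> lines" using assms proj_points_lines_disjoint by blast
  have "(\<Sum>s\<in>points \<union> lines. plane_gram p q r s * x s) =
      (\<Sum>s\<in>points. plane_gram p q r s * x s) + (\<Sum>s\<in>lines. plane_gram p q r s * x s)"
    by (intro sum.union_disjoint) (simp_all add: proj_points_lines_disjoint)
  also have "(\<Sum>s\<in>points. plane_gram p q r s * x s) = (\<Sum>s\<in>points. if s = r then - (of_nat q * x r) else 0)"
    using assms r proj_points_lines_disjoint[where 'a='f]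
    by (intro sum.cong) (auto simp: plane_gram_def)
  also have "(\<Sum>s\<in>lines. plane_gram p q r s * x s) = (\<Sum>s | s \<in> lines \<and> r \<subseteq> s. p * x s)"
    using assms r by (intro sum.mono_neutral_cong_right) (auto simp: plane_gram_def)
  finally show ?thesis using assms by (simp add: sum_distrib_left)
qed

lemma line_row:
  assumes "r \<in> lines"
  shows "(\<Sum>s\<in>points \<union> lines. plane_gram p q r s * x s) =
    qcnj p * (\<Sum>s | s \<in> points \<and> s \<subseteq> r. x s) - of_nat q * x r"
proof -
  have r: "r \<notin> points" using assms proj_points_lines_disjoint by blast
  have "(\<Sum>s\<in>points \<union> lines. plane_gram p q r s * x s) =
      (\<Sum>s\<in>points. plane_gram p q r s * x s) + (\<Sum>s\<in>lines. plane_gram p q r s * x s)"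
    by (intro sum.union_disjoint) (simp_all add: proj_points_lines_disjoint)
  also have "(\<Sum>s\<in>lines. plane_gram p q r s * x s) = (\<Sum>s\<in>lines. if s = r then - (of_nat q * x r) else 0)"
    using assms r proj_points_lines_disjoint[where 'a='f]
    by (intro sum.cong) (auto simp: plane_gram_def)
  also have "(\<Sum>s\<in>points. plane_gram p q r s * x s) = (\<Sum>s | s \<in> points \<and> s \<subseteq> r. qcnj p * x s)"
    using assms r by (intro sum.mono_neutral_cong_right) (auto simp: plane_gram_def)
  finally show ?thesis using assms by (simp add: sum_distrib_left)
qed

lemma card_common_points:
  assumes "l \<in> lines" "m \<in> lines"
  shows "card {s. s \<in> points \<and> s \<subseteq> l \<and> s \<subseteq> m} = (if l = m then q + 1 else 1)"
  using assms card_points_on_line[of l] card_points_on_two_lines[of l m] by (auto simp: card_residue)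

text \<open>The entry \<open>qcnj p\<close> at l balances the points of l: their rows give p times
  \<open>qcnj p\<close> minus q, which is 0. The row of l gives (q + 1) - q times
  \<open>qcnj p\<close>, the same value as the row of any other line, so differences of such vectors
  lie in the radical.\<close>

definition line_vec :: "('f^3) set \<Rightarrow> ('f^3) set \<Rightarrow> quat" where
  "line_vec l = (\<lambda>t. if t \<in> points \<and> t \<subseteq> l then 1 else if t = l then qcnj p else 0)"

lemma line_vec_closed: "l \<in> lines \<Longrightarrow> line_vec l \<in> vecs (plane_lattice0 \<O> p q)"
  by (auto simp: plane.vecs_iff line_vec_def)

lemma line_vec_row:
  assumes l: "l \<in> lines" and r: "r \<in> points \<union> lines"
  shows "(\<Sum>s\<in>points \<union> lines. plane_gram p q r s * line_vec l s) = (if r \<in> points then 0 else qcnj p)"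
proof (cases "r \<in> points")
  case True
  have "(\<Sum>m | m \<in> lines \<and> r \<subseteq> m. line_vec l m) = (\<Sum>m | m \<in> lines \<and> r \<subseteq> m. if m = l then qcnj p else 0)"
    using proj_points_lines_disjoint by (intro sum.cong) (auto simp: line_vec_def)
  also have "\<dots> = (if r \<subseteq> l then qcnj p else 0)" using l by simp
  finally have "(\<Sum>s\<in>points \<union> lines. plane_gram p q r s * line_vec l s) =
      p * (if r \<subseteq> l then qcnj p else 0) - of_nat q * line_vec l r"
    using point_row[OF True] by simp
  also have "\<dots> = 0"
    using True l proj_points_lines_disjoint by (auto simp: line_vec_def p_norm)
  finally show ?thesis using True by simp
next
  case False
  then have rl: "r \<in> lines" using r by simp
  have "(\<Sum>s | s \<in> points \<and> s \<subseteq> r. line_vec l s) = (\<Sum>s | s \<in> points \<and> s \<subseteq> r \<and> s \<subseteq> l. 1)"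
    using l proj_points_lines_disjoint
    by (intro sum.mono_neutral_cong_right) (auto simp: line_vec_def)
  also have "\<dots> = of_nat (if r = l then q + 1 else 1)"
    using card_common_points[OF rl l] by simp
  finally have "(\<Sum>s\<in>points \<union> lines. plane_gram p q r s * line_vec l s) =
      qcnj p * of_nat (if r = l then q + 1 else 1) - of_nat q * line_vec l r"
    using line_row[OF rl] by simp
  also have "\<dots> = qcnj p"
    using False rl by (auto simp: line_vec_def algebra_simps mult_of_nat_commute)
  finally show ?thesis using False by simp
qed

lemma line_vec_diff_radical:
  assumes "l \<in> lines" "m \<in> lines"
  shows "(\<lambda>t. line_vec l t - line_vec m t) \<in> radical (plane_lattice0 \<O> p q)"
proof (rule plane.radicalI)
  show "(\<lambda>t. line_vec l t - line_vec m t) \<in> vecs (plane_lattice0 \<O> p q)"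
    using line_vec_closed[OF assms(1)] line_vec_closed[OF assms(2)] by (auto simp: plane.vecs_iff)
next
  fix r assume "r \<in> points \<union> lines"
  then show "(\<Sum>s\<in>points \<union> lines. plane_gram p q r s * (line_vec l s - line_vec m s)) = 0"
    using line_vec_row[OF assms(1)] line_vec_row[OF assms(2)]
    by (simp add: right_diff_distrib sum_subtractf)
qed

lemma sum_line_vec:
  assumes l: "l \<in> lines"
  shows "(\<Sum>t\<in>points \<union> lines. \<phi> t * line_vec l t) = (\<Sum>s | s \<in> points \<and> s \<subseteq> l. \<phi> s) + \<phi> l * qcnj p"
proof -
  have "(\<Sum>t\<in>points \<union> lines. \<phi> t * line_vec l t) =
      (\<Sum>t\<in>points. \<phi> t * line_vec l t) + (\<Sum>t\<in>lines. \<phi> t * line_vec l t)"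
    by (intro sum.union_disjoint) (simp_all add: proj_points_lines_disjoint)
  also have "(\<Sum>t\<in>points. \<phi> t * line_vec l t) = (\<Sum>s | s \<in> points \<and> s \<subseteq> l. \<phi> s)"
    using l proj_points_lines_disjoint
    by (intro sum.mono_neutral_cong_right) (auto simp: line_vec_def)
  also have "(\<Sum>t\<in>lines. \<phi> t * line_vec l t) = (\<Sum>t\<in>lines. if t = l then \<phi> l * qcnj p else 0)"
    using proj_points_lines_disjoint by (intro sum.cong) (auto simp: line_vec_def)
  finally show ?thesis using l by simp
qed

theorem plane_lattice_p_modular:
  "p_modular \<O> p (plane_lattice \<O> p q :: (('f^3) set \<Rightarrow> quat) set herm_module)"
  unfolding plane_lattice_def
proof (rule plane.p_modular_mod_radicalI)
  fix r s assume "r \<in> points \<union> lines" "s \<in> points \<union> lines"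
  have "- of_nat q \<in> p\<O>"
    unfolding right_multiples_def by (intro CollectI exI[of _ "- qcnj p"]) (simp add: p_norm)
  moreover have "0 \<in> p\<O>" using right_multiples_sum[of "{}"] by simp
  ultimately show "plane_gram p q r s \<in> p\<O>"
    by (simp add: plane_gram_def p_in_right_multiples cnj_p_in_right_multiples)
next
  fix \<phi> assume \<phi>: "\<And>r. r \<in> points \<union> lines \<Longrightarrow> \<phi> r \<in> \<O>"
    and orth: "\<And>z. z \<in> radical (plane_lattice0 \<O> p q) \<Longrightarrow> (\<Sum>r\<in>points \<union> lines. \<phi> r * z r) = 0"
  obtain l0 where l0: "l0 \<in> lines" using proj_lines_nonempty by blast
  define K where "K = qcnj ((\<Sum>s | s \<in> points \<and> s \<subseteq> l0. \<phi> s) + \<phi> l0 * qcnj p)"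
  have K: "(\<Sum>s | s \<in> points \<and> s \<subseteq> l. qcnj (\<phi> s)) + p * qcnj (\<phi> l) = K" if l: "l \<in> lines" for l
  proof -
    have "(\<Sum>s | s \<in> points \<and> s \<subseteq> l. \<phi> s) + \<phi> l * qcnj p = (\<Sum>s | s \<in> points \<and> s \<subseteq> l0. \<phi> s) + \<phi> l0 * qcnj p"
      using orth[OF line_vec_diff_radical[OF l l0]]
      by (simp add: right_diff_distrib sum_subtractf sum_line_vec l l0)
    from arg_cong[OF this, of qcnj] show ?thesis by (simp add: K_def qcnj_sum)
  qed
  \<comment> \<open>Point rows have the left factor p, line rows the left factor
    \<open>qcnj p\<close>; dividing the right-hand side \<open>qcnj (\<phi> r) * p\<close> by them
    gives \<open>c\<close> and \<open>d\<close>. Both are integral because \<open>p\<O>\<close> is a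
    two-sided ideal generated by either factor.\<close>
  define c where "c r = inverse p * qcnj (\<phi> r) * p" for r
  define d where "d r = inverse (qcnj p) * qcnj (\<phi> r) * p" for r
  have pc: "p * c r = qcnj (\<phi> r) * p" and pd: "qcnj p * d r = qcnj (\<phi> r) * p" for r
    by (simp_all add: c_def d_def mult.assoc[symmetric])
  have c: "c r \<in> \<O>" and d: "d r \<in> \<O>" if "r \<in> points \<union> lines" for r
  proof -
    have *: "qcnj (\<phi> r) * p \<in> p\<O>" using \<phi>[OF that] by (intro mult_p_in_right_multiples) simp
    obtain u where "u \<in> \<O>" "qcnj (\<phi> r) * p = p * u" using * by (rule right_multiplesE)
    moreover from this have "c r = u" using pc[of r] by simp
    ultimately show "c r \<in> \<O>" by simp
    obtain u where "u \<in> \<O>" "qcnj (\<phi> r) * p = qcnj p * u" using * by (rule right_multiples_cnjE)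
    moreover from this have "d r = u" using pd[of r] by simp
    ultimately show "d r \<in> \<O>" by simp
  qed
  \<comment> \<open>\<open>c r\<close> arises from \<open>qcnj (\<phi> r)\<close> by the inner
    automorphism of p, so the common value K has to undergo it too.\<close>
  define K' where "K' = inverse p * K * p"
  have cd: "(\<Sum>s | s \<in> points \<and> s \<subseteq> l. c s) + qcnj p * d l = K'" if l: "l \<in> lines" for l
  proof -
    have "p * ((\<Sum>s | s \<in> points \<and> s \<subseteq> l. c s) + qcnj p * d l) = K * p"
      unfolding K[OF l, symmetric]
      by (simp add: distrib_left distrib_right sum_distrib_left sum_distrib_right pc pd mult.assoc)
    moreover have "p * K' = K * p" by (simp add: K'_def mult.assoc[symmetric])
    ultimately have "p * ((\<Sum>s | s \<in> points \<and> s \<subseteq> l. c s) + qcnj p * d l) = p * K'" by simp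
    then show ?thesis by (simp only: mult_cancel_left p_neq_0 simp_thms)
  qed
  \<comment> \<open>Integrality is read off the equation of one line, since the definition of K'
    contains an inverse.\<close>
  have "K' \<in> \<O>" unfolding cd[OF l0, symmetric] using c d l0 by (intro add_closed sum_closed) auto
  have line_sums: "(\<Sum>s | s \<in> points \<and> s \<subseteq> l. \<pi> (c s)) = \<pi> K'" if l: "l \<in> lines" for l
  proof -
    have dl: "d l \<in> \<O>" using d l by simp
    have "(\<Sum>s | s \<in> points \<and> s \<subseteq> l. \<pi> (c s)) = \<pi> (\<Sum>s | s \<in> points \<and> s \<subseteq> l. c s)"
      using c by (intro residue_sum[symmetric]) auto
    also have "(\<Sum>s | s \<in> points \<and> s \<subseteq> l. c s) = K' - qcnj p * d l"
      by (simp flip: cd[OF l])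
    also have "\<pi> \<dots> = \<pi> K' - \<pi> (qcnj p * d l)"
      using \<open>K' \<in> \<O>\<close> dl by (intro residue_diff) auto
    also have "\<pi> (qcnj p * d l) = 0"
      using right_multiples_mult[OF cnj_p_in_right_multiples dl] dl by (simp add: residue_kernel)
    finally show ?thesis by simp
  qed
  obtain \<beta> where \<beta>: "\<And>s. s \<in> points \<Longrightarrow> (\<Sum>l | l \<in> lines \<and> s \<subseteq> l. \<beta> l) = \<pi> (c s)"
    using constant_line_sums_imp_line_combination[OF _ line_sums] prime_q card_residue by blast
  have "\<exists>x. x \<in> \<O> \<and> \<pi> x = \<beta> l" for l using residue_surj by blast
  then obtain b0 where b0: "\<And>l. b0 l \<in> \<O>" "\<And>l. \<pi> (b0 l) = \<beta> l" by metis
  have b0c: "(\<Sum>l | l \<in> lines \<and> s \<subseteq> l. b0 l) - c s \<in> p\<O>" if s: "s \<in> points" for s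
  proof -
    have cl: "(\<Sum>l | l \<in> lines \<and> s \<subseteq> l. b0 l) \<in> \<O>" "c s \<in> \<O>"
      using b0 c s by (auto intro: sum_closed)
    have "\<pi> ((\<Sum>l | l \<in> lines \<and> s \<subseteq> l. b0 l) - c s) = 0"
      using cl b0 by (simp add: residue_diff residue_sum \<beta>[OF s])
    then show ?thesis using cl by (simp add: residue_kernel)
  qed
  have dl: "d l \<in> \<O>" if "l \<in> lines" for l using d that by simp
  obtain a b where ab: "\<forall>s\<in>points. a s \<in> \<O> \<and> (\<Sum>l | l \<in> lines \<and> s \<subseteq> l. b l) - qcnj p * a s = c s"
      "\<forall>l\<in>lines. b l \<in> \<O> \<and> (\<Sum>s | s \<in> points \<and> s \<subseteq> l. a s) - p * b l = d l"
    using solve_incidence_system[of points lines "(\<subseteq>)" d c K' b0, OF finite finite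
        proj_lines_nonempty card_common_points dl cd b0(1) b0c] by blast
  then have eqs: "s \<in> points \<Longrightarrow> (\<Sum>l | l \<in> lines \<and> s \<subseteq> l. b l) - qcnj p * a s = c s"
      "l \<in> lines \<Longrightarrow> (\<Sum>s | s \<in> points \<and> s \<subseteq> l. a s) - p * b l = d l" for s l
    by blast+
  define x where "x r = (if r \<in> points then a r else if r \<in> lines then b r else 0)" for r
  have "x \<in> vecs (plane_lattice0 \<O> p q)"
    using ab by (auto simp: plane.vecs_iff x_def)
  moreover have "(\<Sum>s\<in>points \<union> lines. plane_gram p q r s * x s) = qcnj (\<phi> r) * p"
    if r: "r \<in> points \<union> lines" for r
  proof (cases "r \<in> points")
    case True
    have "(\<Sum>l | l \<in> lines \<and> r \<subseteq> l. x l) = (\<Sum>l | l \<in> lines \<and> r \<subseteq> l. b l)"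
      using proj_points_lines_disjoint by (intro sum.cong) (auto simp: x_def)
    then have "(\<Sum>s\<in>points \<union> lines. plane_gram p q r s * x s) =
        p * ((\<Sum>l | l \<in> lines \<and> r \<subseteq> l. b l) - qcnj p * a r)"
      using True by (simp add: point_row x_def right_diff_distrib p_cnj_p_left)
    then show ?thesis by (simp only: eqs(1)[OF True] pc)
  next
    case False
    then have rl: "r \<in> lines" using r by simp
    have "(\<Sum>s | s \<in> points \<and> s \<subseteq> r. x s) = (\<Sum>s | s \<in> points \<and> s \<subseteq> r. a s)"
      by (intro sum.cong) (auto simp: x_def)
    then have "(\<Sum>s\<in>points \<union> lines. plane_gram p q r s * x s) =
        qcnj p * ((\<Sum>s | s \<in> points \<and> s \<subseteq> r. a s) - p * b r)"
      using False rl by (simp add: line_row x_def right_diff_distrib cnj_p_p_left)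
    then show ?thesis by (simp only: eqs(2)[OF rl] pd)
  qed
  ultimately show "\<exists>x\<in>vecs (plane_lattice0 \<O> p q). \<forall>s\<in>points \<union> lines.
      (\<Sum>r\<in>points \<union> lines. plane_gram p q s r * x r) = qcnj (\<phi> s) * p" by blast
qed

end

section \<open>Rings of integers of imaginary quadratic fields\<close>

text \<open>In lowest terms m / n every power n^k divides D; for n at least 2 the power n^D would
  exceed D.\<close>

lemma rat_Ints_of_bounded_denominators:
  fixes r :: rat
  assumes "D > (0::nat)" "\<And>k. of_nat D * r ^ k \<in> \<int>"
  shows "r \<in> \<int>"
proof -
  obtain m n where mn: "quotient_of r = (m, n)" by fastforce
  have n: "n > 0" and cop: "coprime m n" and r: "r = of_int m / of_int n"
    using quotient_of_denom_pos[OF mn] quotient_of_coprime[OF mn] quotient_of_div[OF mn] by auto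
  have dvd: "n ^ k dvd int D" for k
  proof -
    obtain j where j: "of_nat D * r ^ k = of_int j" using assms(2)[of k] by (elim Ints_cases)
    then have "of_int (int D * m ^ k) = (of_int (j * n ^ k) :: rat)"
      using n by (simp add: r field_simps)
    then have "int D * m ^ k = j * n ^ k" by (simp only: of_int_eq_iff)
    then have "n ^ k dvd int D * m ^ k" by simp
    then show ?thesis
      using cop by (simp add: coprime_commute coprime_dvd_mult_left_iff)
  qed
  have "n = 1"
  proof (rule ccontr)
    assume "n \<noteq> 1"
    then have "n \<ge> 2" using n by simp
    then have "(2::int) ^ D \<le> n ^ D" by (simp add: power_mono)
    moreover have "int D < 2 ^ D" by (rule of_nat_less_two_power)
    moreover have "n ^ D \<le> int D" using dvd[of D] assms(1) by (intro zdvd_imp_le) auto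
    ultimately show False by linarith
  qed
  then show ?thesis by (simp add: r)
qed

lemma complex_of_rat: "(of_rat r :: complex) = of_real (of_rat r)"
  by (cases r) (simp add: of_rat_rat)

locale quadratic_order =
  fixes d :: nat
  assumes d_pos: "d > 0"
begin

definition \<omega> :: complex where "\<omega> = \<i> * of_real (sqrt (real d))"

text \<open>The order Z[sqrt(-d)], possibly smaller than the ring of integers, is the reference
  against which denominators are measured.\<close>

definition \<Lambda> :: "complex set" where "\<Lambda> = {of_int a + of_int b * \<omega> | a b. True}"

lemma omega_sqrd: "\<omega> * \<omega> = - of_nat d"
  by (simp add: \<omega>_def complex_eq_iff)

lemma \<Lambda>_I: "of_int a + of_int b * \<omega> \<in> \<Lambda>"
  by (auto simp: \<Lambda>_def)

lemma \<Lambda>_add: "x \<in> \<Lambda> \<Longrightarrow> y \<in> \<Lambda> \<Longrightarrow> x + y \<in> \<Lambda>"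
proof -
  assume "x \<in> \<Lambda>" "y \<in> \<Lambda>"
  then obtain a b a' b' where "x = of_int a + of_int b * \<omega>" "y = of_int a' + of_int b' * \<omega>"
    by (auto simp: \<Lambda>_def)
  then have "x + y = of_int (a + a') + of_int (b + b') * \<omega>" by (simp add: algebra_simps)
  then show ?thesis by (simp only: \<Lambda>_I)
qed

lemma \<Lambda>_mult: "x \<in> \<Lambda> \<Longrightarrow> y \<in> \<Lambda> \<Longrightarrow> x * y \<in> \<Lambda>"
proof -
  assume "x \<in> \<Lambda>" "y \<in> \<Lambda>"
  then obtain a b a' b' where xy: "x = of_int a + of_int b * \<omega>" "y = of_int a' + of_int b' * \<omega>"
    by (auto simp: \<Lambda>_def)
  have "x * y = of_int a * of_int a' + of_int b * of_int b' * (\<omega> * \<omega>) +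
      (of_int a * of_int b' + of_int b * of_int a') * \<omega>"
    by (simp add: xy algebra_simps)
  also have "\<dots> = of_int (a * a' - b * b' * int d) + of_int (a * b' + b * a') * \<omega>"
    by (simp add: omega_sqrd)
  finally show ?thesis by (simp only: \<Lambda>_I)
qed

lemma \<Lambda>_of_int: "of_int a \<in> \<Lambda>"
  using \<Lambda>_I[of a 0] by simp

lemma \<Lambda>_of_nat: "of_nat a \<in> \<Lambda>"
  using \<Lambda>_of_int[of "int a"] by simp

lemma \<Lambda>_sum: "(\<And>i. i \<in> A \<Longrightarrow> f i \<in> \<Lambda>) \<Longrightarrow> sum f A \<in> \<Lambda>"
  by (induction A rule: infinite_finite_induct) (use \<Lambda>_of_int[of 0] in \<open>auto simp: \<Lambda>_add\<close>)

lemma \<Lambda>_power: "x \<in> \<Lambda> \<Longrightarrow> x ^ k \<in> \<Lambda>"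
  by (induction k) (use \<Lambda>_of_int[of 1] in \<open>auto simp: \<Lambda>_mult\<close>)

lemma \<Lambda>_cnj: "x \<in> \<Lambda> \<Longrightarrow> cnj x \<in> \<Lambda>"
proof -
  assume "x \<in> \<Lambda>"
  then obtain a b where "x = of_int a + of_int b * \<omega>" by (auto simp: \<Lambda>_def)
  then have "cnj x = of_int a + of_int (- b) * \<omega>" by (simp add: \<omega>_def)
  then show ?thesis by (simp only: \<Lambda>_I)
qed

lemma \<Lambda>_rat:
  assumes "of_rat r \<in> \<Lambda>"
  shows "r \<in> \<int>"
proof -
  obtain a b where "of_rat r = of_int a + of_int b * \<omega>" using assms by (auto simp: \<Lambda>_def)
  then have "of_rat r = real_of_int a" by (simp add: \<omega>_def complex_of_rat complex_eq_iff)
  then have "of_rat r = (of_rat (of_int a) :: real)" by simp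
  then have "r = of_int a" by (simp only: of_rat_eq_iff)
  then show ?thesis by simp
qed

text \<open>
  On the field, having powers of bounded denominator is equivalent to integrality, and visibly
  stable under sums and products.
\<close>

definition bounded_denom :: "complex \<Rightarrow> bool" where
  "bounded_denom z \<longleftrightarrow> (\<exists>D>0. \<forall>k. of_nat D * z ^ k \<in> \<Lambda>)"

lemma bounded_denom_mult:
  assumes "bounded_denom z" "bounded_denom w"
  shows "bounded_denom (z * w)"
proof -
  obtain D E where "D > 0" "E > 0" and DE: "\<And>k. of_nat D * z ^ k \<in> \<Lambda>" "\<And>k. of_nat E * w ^ k \<in> \<Lambda>"
    using assms by (auto simp: bounded_denom_def)
  have "of_nat (D * E) * (z * w) ^ k = (of_nat D * z ^ k) * (of_nat E * w ^ k)" for k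
    by (simp add: power_mult_distrib)
  then have "of_nat (D * E) * (z * w) ^ k \<in> \<Lambda>" for k by (simp only: \<Lambda>_mult DE)
  then show ?thesis
    using \<open>D > 0\<close> \<open>E > 0\<close> unfolding bounded_denom_def by (intro exI[of _ "D * E"]) simp
qed

text \<open>In the binomial expansion D goes with the power of z and E with the power of w, so the
  fixed product D E clears every power of the sum.\<close>

lemma bounded_denom_add:
  assumes "bounded_denom z" "bounded_denom w"
  shows "bounded_denom (z + w)"
proof -
  obtain D E where "D > 0" "E > 0" and DE: "\<And>k. of_nat D * z ^ k \<in> \<Lambda>" "\<And>k. of_nat E * w ^ k \<in> \<Lambda>"
    using assms by (auto simp: bounded_denom_def)
  have "of_nat (D * E) * (z + w) ^ k =
      (\<Sum>i\<le>k. of_nat (k choose i) * ((of_nat D * z ^ i) * (of_nat E * w ^ (k - i))))" for k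
    by (simp add: binomial_ring sum_distrib_left mult_ac)
  then have "of_nat (D * E) * (z + w) ^ k \<in> \<Lambda>" for k
    by (simp only:) (intro \<Lambda>_sum \<Lambda>_mult \<Lambda>_of_nat DE)
  then show ?thesis
    using \<open>D > 0\<close> \<open>E > 0\<close> unfolding bounded_denom_def by (intro exI[of _ "D * E"]) simp
qed

lemma bounded_denom_cnj:
  assumes "bounded_denom z"
  shows "bounded_denom (cnj z)"
proof -
  obtain D where "D > 0" and D: "\<And>k. of_nat D * z ^ k \<in> \<Lambda>"
    using assms by (auto simp: bounded_denom_def)
  have "of_nat D * cnj z ^ k \<in> \<Lambda>" for k using \<Lambda>_cnj[OF D[of k]] by simp
  then show ?thesis using \<open>D > 0\<close> unfolding bounded_denom_def by (intro exI[of _ D]) simp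
qed

lemma bounded_denom_rat:
  assumes "bounded_denom (of_rat r)"
  shows "r \<in> \<int>"
proof -
  obtain D where "D > 0" and D: "\<And>k. of_nat D * of_rat r ^ k \<in> \<Lambda>"
    using assms by (auto simp: bounded_denom_def)
  have "of_rat (of_nat D * r ^ k) \<in> \<Lambda>" for k
    using D[of k] by (simp add: of_rat_mult of_rat_power)
  then show ?thesis by (rule rat_Ints_of_bounded_denominators[OF \<open>D > 0\<close> \<Lambda>_rat])
qed

definition K :: "complex set" where
  "K = {of_rat a + of_rat b * \<omega> | a b. True}"

lemma K_I: "of_rat a + of_rat b * \<omega> \<in> K"
  by (auto simp: K_def)

text \<open>If E is a denominator of z and N the degree of a monic equation, then E^N clears the
  powers below N, and the equation reduces higher powers to these without new denominators.\<close>

lemma algebraic_int_imp_bounded_denom: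
  assumes "z \<in> K" "algebraic_int z"
  shows "bounded_denom z"
proof -
  obtain a b where z: "z = of_rat a + of_rat b * \<omega>" using assms by (auto simp: K_def)
  obtain m n m' n' where mn: "quotient_of a = (m, n)" "quotient_of b = (m', n')"
    by (metis surj_pair)
  have n: "n > 0" "n' > 0" and ab: "a = of_int m / of_int n" "b = of_int m' / of_int n'"
    using quotient_of_denom_pos[OF mn(1)] quotient_of_denom_pos[OF mn(2)]
      quotient_of_div[OF mn(1)] quotient_of_div[OF mn(2)] by auto
  define E where "E = nat (n * n')"
  have E: "E > 0" and E': "of_nat E = (of_int n * of_int n' :: complex)"
    using n by (auto simp: E_def simp flip: of_int_mult)
  have "of_nat E * z = of_int (m * n') + of_int (m' * n) * \<omega>"
    using n by (simp add: E' z ab of_rat_divide field_simps)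
  then have Ez: "of_nat E * z \<in> \<Lambda>" by (simp only: \<Lambda>_I)
  obtain P where P: "lead_coeff P = 1" "\<And>i. Polynomial.coeff P i \<in> \<int>" "poly P z = 0"
    using assms(2) by (auto elim: algebraic_int.cases)
  let ?N = "Polynomial.degree P"
  have red: "z ^ ?N = - (\<Sum>i<?N. Polynomial.coeff P i * z ^ i)"
  proof -
    have "0 = (\<Sum>i<Suc ?N. Polynomial.coeff P i * z ^ i)"
      using P(3) by (simp only: poly_altdef lessThan_Suc_atMost)
    also have "\<dots> = (\<Sum>i<?N. Polynomial.coeff P i * z ^ i) + z ^ ?N" using P(1) by simp
    finally show ?thesis by (simp add: eq_neg_iff_add_eq_0 add.commute)
  qed
  have "of_nat (E ^ ?N) * z ^ k \<in> \<Lambda>" for k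
  proof (induction k rule: less_induct)
    case (less k)
    show ?case
    proof (cases "k < ?N")
      case True
      then have "of_nat (E ^ ?N) * z ^ k = of_nat (E ^ (?N - k)) * (of_nat E * z) ^ k"
        by (simp add: power_mult_distrib mult.assoc[symmetric] power_add[symmetric])
      then show ?thesis by (simp only: \<Lambda>_mult \<Lambda>_of_nat \<Lambda>_power Ez)
    next
      case False
      then have "z ^ k = z ^ (k - ?N) * z ^ ?N" by (simp add: power_add[symmetric])
      then have "of_nat (E ^ ?N) * z ^ k =
          (\<Sum>i<?N. - Polynomial.coeff P i * (of_nat (E ^ ?N) * z ^ (k - ?N + i)))"
        by (simp add: red sum_distrib_left sum_negf power_add mult_ac)
      also have "\<dots> \<in> \<Lambda>"
      proof (rule \<Lambda>_sum, rule \<Lambda>_mult)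
        fix i assume "i \<in> {..<?N}"
        then show "of_nat (E ^ ?N) * z ^ (k - ?N + i) \<in> \<Lambda>" using False by (intro less) auto
        obtain j where "Polynomial.coeff P i = of_int j" using P(2)[of i] by (elim Ints_cases)
        then show "- Polynomial.coeff P i \<in> \<Lambda>" using \<Lambda>_of_int[of "- j"] by simp
      qed
      finally show ?thesis .
    qed
  qed
  then show ?thesis
    using E unfolding bounded_denom_def by (intro exI[of _ "E ^ ?N"]) auto
qed

text \<open>Trace and norm of z are rational and inherit bounded denominators, hence are integers;
  up to sign they are the coefficients of a monic quadratic equation for z.\<close>

lemma bounded_denom_imp_algebraic_int:
  assumes "z \<in> K" "bounded_denom z"
  shows "algebraic_int z"
proof -
  obtain a b where z: "z = of_rat a + of_rat b * \<omega>" using assms by (auto simp: K_def)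
  have tr: "z + cnj z = of_rat (2 * a)"
    by (simp add: z complex_of_rat \<omega>_def complex_eq_iff of_rat_mult)
  have nm: "z * cnj z = of_rat (a * a + b * b * of_nat d)"
    by (simp add: z complex_of_rat \<omega>_def complex_eq_iff of_rat_mult of_rat_add)
  have "bounded_denom (of_rat (2 * a))" "bounded_denom (of_rat (a * a + b * b * of_nat d))"
    unfolding tr[symmetric] nm[symmetric] using assms(2)
    by (simp_all add: bounded_denom_add bounded_denom_mult bounded_denom_cnj)
  then have "2 * a \<in> \<int>" "a * a + b * b * of_nat d \<in> \<int>"
    by (auto intro: bounded_denom_rat)
  then obtain t n where tn: "2 * a = of_int t" "a * a + b * b * of_nat d = of_int n"
    by (auto elim!: Ints_cases)
  have t: "z + cnj z = of_int t" and n: "z * cnj z = of_int n"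
    unfolding tr nm tn by simp_all
  show ?thesis
  proof (rule algebraic_int.intros)
    let ?P = "[:of_int n, - of_int t, 1:] :: complex poly"
    show "lead_coeff ?P = 1" by simp
    show "\<forall>i. Polynomial.coeff ?P i \<in> \<int>"
      by (auto simp: coeff_pCons split: nat.splits)
    show "poly ?P z = 0"
      unfolding t[symmetric] n[symmetric] by (simp add: algebra_simps)
  qed
qed

lemma K_closed:
  assumes "z \<in> K" "w \<in> K"
  shows "z + w \<in> K" "z * w \<in> K"
proof -
  obtain a b a' b' where zw: "z = of_rat a + of_rat b * \<omega>" "w = of_rat a' + of_rat b' * \<omega>"
    using assms by (auto simp: K_def)
  have "z + w = of_rat (a + a') + of_rat (b + b') * \<omega>"
    by (simp add: zw of_rat_add algebra_simps)
  then show "z + w \<in> K" by (simp only: K_I)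
  have "z * w = of_rat a * of_rat a' + of_rat b * of_rat b' * (\<omega> * \<omega>) +
      (of_rat a * of_rat b' + of_rat b * of_rat a') * \<omega>"
    by (simp add: zw algebra_simps)
  also have "\<dots> = of_rat (a * a' - b * b' * of_nat d) + of_rat (a * b' + b * a') * \<omega>"
    by (simp add: omega_sqrd of_rat_mult of_rat_diff of_rat_add)
  finally show "z * w \<in> K" by (simp only: K_I)
qed

lemma K_cnj:
  assumes "z \<in> K"
  shows "cnj z \<in> K"
proof -
  obtain a b where "z = of_rat a + of_rat b * \<omega>" using assms by (auto simp: K_def)
  then have "cnj z = of_rat a + of_rat (- b) * \<omega>" by (simp add: \<omega>_def complex_of_rat of_rat_minus)
  then show ?thesis by (simp only: K_I)
qed

lemma K_of_int: "of_int n \<in> K"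
  using K_I[of "of_int n" 0] by simp

lemma ring_of_integers_iff: "z \<in> ring_of_integers K \<longleftrightarrow> z \<in> K \<and> bounded_denom z"
  using algebraic_int_imp_bounded_denom bounded_denom_imp_algebraic_int
  by (auto simp: ring_of_integers_def)

lemma ring_of_integers_of_int: "of_int n \<in> ring_of_integers K"
  by (simp add: ring_of_integers_def K_of_int int_imp_algebraic_int)

lemma ring_of_integers_add:
  "z \<in> ring_of_integers K \<Longrightarrow> w \<in> ring_of_integers K \<Longrightarrow> z + w \<in> ring_of_integers K"
  by (simp add: ring_of_integers_iff K_closed bounded_denom_add)

lemma ring_of_integers_mult:
  "z \<in> ring_of_integers K \<Longrightarrow> w \<in> ring_of_integers K \<Longrightarrow> z * w \<in> ring_of_integers K"
  by (simp add: ring_of_integers_iff K_closed bounded_denom_mult)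

lemma ring_of_integers_diff:
  "z \<in> ring_of_integers K \<Longrightarrow> w \<in> ring_of_integers K \<Longrightarrow> z - w \<in> ring_of_integers K"
  using ring_of_integers_add[OF _ ring_of_integers_mult[OF ring_of_integers_of_int[of "-1"]], of z w]
  by simp

lemma ring_of_integers_cnj: "z \<in> ring_of_integers K \<Longrightarrow> cnj z \<in> ring_of_integers K"
  by (simp add: ring_of_integers_iff K_cnj bounded_denom_cnj)

end

section \<open>Admissible triples\<close>

lemma quat_of_complex_hom:
  "quat_of_complex 1 = 1" "quat_of_complex z - quat_of_complex w = quat_of_complex (z - w)"
  "quat_of_complex z * quat_of_complex w = quat_of_complex (z * w)"
  "qcnj (quat_of_complex z) = quat_of_complex (cnj z)"
  by (simp_all add: quat_eq_iff quat_of_complex_def)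

lemma qnorm_sqrd: "(qnorm z)\<^sup>2 = (qRe z)\<^sup>2 + (qI z)\<^sup>2 + (qJ z)\<^sup>2 + (qK z)\<^sup>2"
  by (simp add: qnorm_def)

lemma qnorm_mult_sqrd: "(qnorm (z * w))\<^sup>2 = (qnorm z)\<^sup>2 * (qnorm w)\<^sup>2"
  unfolding qnorm_sqrd times_quat.sel by (simp add: power2_eq_square algebra_simps)

text \<open>With half-integral coordinates each square is an integer plus a quarter, and the four
  quarters add up to 1.\<close>

lemma qnorm_sqrd_hurwitz:
  assumes "z \<in> hurwitz_integers"
  shows "(qnorm z)\<^sup>2 \<in> \<int>"
proof (cases "{qRe z, qI z, qJ z, qK z} \<subseteq> \<int>")
  case True
  then show ?thesis unfolding qnorm_sqrd by (intro Ints_add Ints_power) auto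
next
  case False
  then have "{qRe z - 1/2, qI z - 1/2, qJ z - 1/2, qK z - 1/2} \<subseteq> \<int>"
    using assms by (auto simp: hurwitz_integers_def)
  then obtain a b c d where "qRe z - 1/2 = of_int a" "qI z - 1/2 = of_int b"
      "qJ z - 1/2 = of_int c" "qK z - 1/2 = of_int d"
    by (auto elim!: Ints_cases)
  then have "qRe z = of_int a + 1/2" "qI z = of_int b + 1/2" "qJ z = of_int c + 1/2" "qK z = of_int d + 1/2"
    by simp_all
  then have "(qnorm z)\<^sup>2 = of_int (a\<^sup>2 + a + b\<^sup>2 + b + c\<^sup>2 + c + d\<^sup>2 + d + 1)"
    unfolding qnorm_sqrd by (simp add: power2_eq_square algebra_simps)
  then show ?thesis by (simp only: Ints_of_int)
qed

text \<open>
  The congruence \<open>qcnj z \<equiv> z\<close> fails in the Hurwitz integers: for \<open>z = (1 + i + j + k) / 2\<close> and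
  \<open>z = i\<close> it makes \<open>q\<close> a divisor of 3 and of 4.
\<close>

lemma not_admissible_hurwitz: "\<not> admissible hurwitz_integers p q"
proof
  assume adm: "admissible hurwitz_integers p q"
  have dvd: "\<exists>m. (qnorm (qcnj z - z))\<^sup>2 = of_int (int q * m)" if "z \<in> hurwitz_integers" for z
  proof -
    have "qcnj z - z \<in> right_multiples hurwitz_integers p"
      using adm that by (simp add: admissible_def)
    then obtain a where a: "a \<in> hurwitz_integers" "qcnj z - z = p * a"
      by (auto simp: right_multiples_def)
    obtain m where "(qnorm a)\<^sup>2 = of_int m" using qnorm_sqrd_hurwitz[OF a(1)] by (elim Ints_cases)
    then have "(qnorm (qcnj z - z))\<^sup>2 = of_int (int q * m)"
      using adm by (simp add: a qnorm_mult_sqrd admissible_def)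
    then show ?thesis ..
  qed
  \<comment> \<open>The differences \<open>qcnj z - z\<close> are -(i + j + k) and -2 i, of squared
    norm 3 and 4.\<close>
  have "Quat (1/2) (1/2) (1/2) (1/2) \<in> hurwitz_integers" "Quat 0 1 0 0 \<in> hurwitz_integers"
    by (simp_all add: hurwitz_integers_def)
  from this[THEN dvd] obtain m n where "real_of_int (int q * m) = 3" "real_of_int (int q * n) = 4"
    by (auto simp: qnorm_sqrd)
  then have "int q * m = 3" "int q * n = 4" by linarith+
  then have "int q * (n - m) = 1" by (simp add: algebra_simps)
  then have "q = 1" using zmult_eq_1_iff by auto
  then show False using adm by (simp add: admissible_def)
qed

lemma qcnj_of_int: "qcnj (of_int n) = of_int n"
  by (cases n rule: int_cases2) simp_all

lemma admissible_imp_conj_congruent_order: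
  assumes adm: "admissible \<O> p q"
  shows "conj_congruent_order \<O> p q"
proof -
  have closed: "1 \<in> \<O> \<and> (\<forall>x\<in>\<O>. \<forall>y\<in>\<O>. x - y \<in> \<O> \<and> x * y \<in> \<O>) \<and> (\<forall>x\<in>\<O>. qcnj x \<in> \<O>)"
  proof -
    consider "\<O> = \<int>" | K where "imag_quadratic_field K" "\<O> = quat_of_complex ` ring_of_integers K"
      using adm not_admissible_hurwitz unfolding admissible_def by blast
    then show ?thesis
    proof cases
      case 1
      then show ?thesis by (auto simp: qcnj_of_int elim!: Ints_cases)
    next
      case 2
      then obtain d where d: "d > 0" and
        K: "K = {of_rat a + of_rat b * (\<i> * of_real (sqrt (real d))) | a b. True}"
        unfolding imag_quadratic_field_def by blast
      interpret quadratic_order d using d by unfold_locales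
      have K: "K = quadratic_order.K d" by (simp add: K K_def \<omega>_def)
      show ?thesis
        unfolding 2(2) K using ring_of_integers_of_int[of 1]
        by (auto simp: quat_of_complex_hom ring_of_integers_diff ring_of_integers_mult
            ring_of_integers_cnj intro!: imageI image_eqI[of 1 _ 1])
    qed
  qed
  show ?thesis
  proof unfold_locales
    show "q > 0" using adm by (auto simp: admissible_def intro: Nat.gr0I)
    show "p * qcnj p = of_nat q"
      using adm by (intro mult_qcnj_eq_of_nat) (simp add: admissible_def)
  qed (use adm closed in \<open>auto simp: admissible_def\<close>)
qed

section \<open>Reduction modulo p as a ring quotient\<close>

context conj_congruent_order
begin

lemma ring_ring_of: "ring (ring_of \<O>)"
proof (intro ringI abelian_groupI monoidI)
  fix x assume "x \<in> carrier (ring_of \<O>)"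
  then show "\<exists>y\<in>carrier (ring_of \<O>). y \<oplus>\<^bsub>ring_of \<O>\<^esub> x = \<zero>\<^bsub>ring_of \<O>\<^esub>"
    by (intro bexI[of _ "- x"]) (simp_all add: ring_of_def)
qed (simp_all add: ring_of_def algebra_simps)

lemma ideal_right_multiples: "ideal p\<O> (ring_of \<O>)"
proof (rule idealI[OF ring_ring_of])
  interpret R: ring "ring_of \<O>" by (rule ring_ring_of)
  show "subgroup p\<O> (add_monoid (ring_of \<O>))"
  proof (rule R.add.subgroupI)
    show "p\<O> \<subseteq> carrier (ring_of \<O>)" using right_multiples_subset by (auto simp: ring_of_def)
    show "p\<O> \<noteq> {}" using p_in_right_multiples by blast
    fix a assume a: "a \<in> p\<O>"
    then have "a * - 1 \<in> p\<O>" by (rule right_multiples_mult) simp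
    moreover have "\<ominus>\<^bsub>ring_of \<O>\<^esub> a = - a"
      using right_multiples_subset[OF a] by (intro R.minus_equality) (simp_all add: ring_of_def)
    ultimately show "\<ominus>\<^bsub>ring_of \<O>\<^esub> a \<in> p\<O>" by simp
  qed (simp add: ring_of_def right_multiples_add)
qed (simp_all add: ring_of_def right_multiples_mult mult_in_right_multiples)

text \<open>The map is the projection to the quotient followed by the given isomorphism, whose
  injectivity keeps the kernel equal to \<open>p\<O>\<close>.\<close>

lemma residue_map_exists:
  assumes "ring_of \<O> Quot p\<O> \<simeq> ring_of (UNIV :: 'f::field set)"
  shows "\<exists>\<pi> :: quat \<Rightarrow> 'f. (\<forall>x\<in>\<O>. \<forall>y\<in>\<O>. \<pi> (x + y) = \<pi> x + \<pi> y) \<and>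
    (\<forall>x\<in>\<O>. \<pi> x = 0 \<longleftrightarrow> x \<in> p\<O>) \<and> (\<forall>\<alpha>. \<exists>x\<in>\<O>. \<pi> x = \<alpha>)"
proof -
  let ?R = "ring_of \<O>" and ?F = "ring_of (UNIV :: 'f set)"
  interpret I: ideal "p\<O>" ?R by (rule ideal_right_multiples)
  interpret Q: ring "?R Quot p\<O>" by (rule I.quotient_is_ring)
  obtain h where h: "h \<in> ring_hom (?R Quot p\<O>) ?F" "bij_betw h (carrier (?R Quot p\<O>)) (carrier ?F)"
    using assms by (auto simp: is_ring_iso_def ring_iso_def)
  define \<pi> where "\<pi> x = h (p\<O> +>\<^bsub>?R\<^esub> x)" for x
  have coset: "(\<lambda>x. p\<O> +>\<^bsub>?R\<^esub> x) \<in> ring_hom ?R (?R Quot p\<O>)" by (rule I.rcos_ring_hom)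
  have comp: "\<pi> (x + y) = \<pi> x + \<pi> y" if "x \<in> \<O>" "y \<in> \<O>" for x y
    using that ring_hom_add[OF coset, of x y] ring_hom_closed[OF coset]
      ring_hom_add[OF h(1)] by (simp add: \<pi>_def ring_of_def)
  have const: "p\<O> +>\<^bsub>?R\<^esub> x = p\<O>" if "x \<in> p\<O>" for x using that by (rule I.a_rcos_const)
  have "0 \<in> p\<O>" using right_multiples_sum[of "{}"] by simp
  have "\<pi> (0 + 0) = \<pi> 0 + \<pi> 0" by (rule comp) simp_all
  then have "\<pi> 0 + 0 = \<pi> 0 + \<pi> 0" by (simp only: add_0_right)
  then have "\<pi> 0 = 0" by (metis add_left_imp_eq)
  then have h0: "h p\<O> = 0" using const[OF \<open>0 \<in> p\<O>\<close>] by (simp add: \<pi>_def)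
  show ?thesis
  proof (intro exI[of _ \<pi>] conjI ballI allI)
    show "\<pi> (x + y) = \<pi> x + \<pi> y" if "x \<in> \<O>" "y \<in> \<O>" for x y using that by (rule comp)
    show "\<pi> x = 0 \<longleftrightarrow> x \<in> p\<O>" if "x \<in> \<O>" for x
    proof
      have car: "x \<in> carrier ?R" "0 \<in> carrier ?R" using that by (simp_all add: ring_of_def)
      assume "\<pi> x = 0"
      then have "h (p\<O> +>\<^bsub>?R\<^esub> x) = h (p\<O> +>\<^bsub>?R\<^esub> 0)"
        using h0 const[OF \<open>0 \<in> p\<O>\<close>] by (simp add: \<pi>_def)
      then have "p\<O> +>\<^bsub>?R\<^esub> x = p\<O> +>\<^bsub>?R\<^esub> 0"
        using h(2) ring_hom_closed[OF coset] car by (auto simp: bij_betw_def dest: inj_onD)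
      then show "x \<in> p\<O>"
        using I.a_rcos_self[OF car(1)] const[OF \<open>0 \<in> p\<O>\<close>] by simp
    next
      assume "x \<in> p\<O>"
      then show "\<pi> x = 0" using h0 const by (simp add: \<pi>_def)
    qed
    show "\<exists>x\<in>\<O>. \<pi> x = \<alpha>" for \<alpha>
    proof -
      have "\<alpha> \<in> h ` carrier (?R Quot p\<O>)" using h(2) by (simp add: bij_betw_def ring_of_def)
      then obtain X where X: "X \<in> carrier (?R Quot p\<O>)" "h X = \<alpha>" by blast
      then obtain x where "x \<in> \<O>" "X = p\<O> +>\<^bsub>?R\<^esub> x"
        by (auto simp: FactRing_def A_RCOSETS_def' ring_of_def)
      then show ?thesis using X by (auto simp: \<pi>_def)
    qed
  qed
qed

end

theorem theorem2p9:
  fixes \<O> :: "quat set" and p :: quat and q :: nat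
  assumes "admissible \<O> p q"
    and "Factorial_Ring.prime q"
    and "CARD('f::{field,finite}) = q"
    and "ring_of \<O> Quot right_multiples \<O> p \<simeq> ring_of (UNIV :: 'f set)"
  shows "p_modular \<O> p
    (plane_lattice \<O> p q :: (('f::{field,finite}^3) set \<Rightarrow> quat) set herm_module)"
proof -
  interpret conj_congruent_order \<O> p q
    using assms(1) by (rule admissible_imp_conj_congruent_order)
  obtain \<pi> :: "quat \<Rightarrow> 'f" where "\<forall>x\<in>\<O>. \<forall>y\<in>\<O>. \<pi> (x + y) = \<pi> x + \<pi> y"
    "\<forall>x\<in>\<O>. \<pi> x = 0 \<longleftrightarrow> x \<in> right_multiples \<O> p" "\<forall>\<alpha>. \<exists>x\<in>\<O>. \<pi> x = \<alpha>"
    using residue_map_exists[OF assms(4)] by blast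
  then interpret residue_order \<O> p q \<pi>
    using assms(2,3) by unfold_locales auto
  show ?thesis by (rule plane_lattice_p_modular)
qed

end
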